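(* Assume that the symmetric positive definite matrices $\tilde M_v$ and $\tilde M_e$ are spectrally equivalent to $M_v$ and $M_e$ respectively, with constants independent of $h$. Then the operators $\mathcal G_h^c$ and $\mathcal G_h^d$ are uniform preconditioners for $\mathcal L_h^c$ and $\mathcal L_h^d$ respectively; i.e. the operator norms $$\|\mathcal G_h^c\mathcal L_h^c\|,\quad\|(\mathcal G_h^c\mathcal L_h^c)^{-1}\|\quad\text{on } S_h\times\boldsymbol U_h,\qquad\|\mathcal G_h^d\mathcal L_h^d\|,\quad\|(\mathcal G_h^d\mathcal L_h^d)^{-1}\|\quad\text{on }\boldsymbol U_h\times\boldsymbol V_h$$ (with respect to the product norm $(\|\cdot\|_M,\|\cdot\|_A)$) are bounded by constants independent of $h$.
   Context: Setting. $\Omega\subset\mathbb R^3$ is a bounded convex polyhedron homeomorphic to a ball, $(\cdot,\cdot)$ is the $L^2(\Omega)$ inner product, and $\mathcal T_h$ is a mesh of size $h$ from a shape-regular quasi-uniform family. $S_h\subset H^1_0$ (Lagrange elements), $\boldsymbol U_h\subset\boldsymbol H_0(\mathrm{curl})$ (edge elements), $\boldsymbol V_h\subset\boldsymbol H_0(\mathrm{div})$ (face elements), $W_h\subset L_0^2$ (discontinuous piecewise polynomials) are finite element spaces on $\mathcal T_h$ such that $0\to S_h\xrightarrow{\mathrm{grad}}\boldsymbol U_h\xrightarrow{\mathrm{curl}}\boldsymbol V_h\xrightarrow{\mathrm{div}}W_h\to0$ is exact. Primes denote dual spaces and $\langle\cdot,\cdot\rangle$ the duality pairing. Curl case: $\langle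 M_v\sigma,\tau\rangle=(\sigma,\tau)$ for $\sigma,\tau\in S_h$; $B:\boldsymbol U_h\to S_h'$, $\langle B\boldsymbol u,\tau\rangle=(\boldsymbol u,\mathrm{grad}\,\tau)$; $C^TM_fC:\boldsymbol U_h\to\boldsymbol U_h'$, $\langle C^TM_fC\boldsymbol u,\boldsymbol v\rangle=(\mathrm{curl}\,\boldsymbol u,\mathrm{curl}\,\boldsymbol v)$. Then $\mathcal L_h^c=\begin{pmatrix} -M_v & B \\ B^T & C^TM_fC \end{pmatrix}$, $A_h^c=B^TM_v^{-1}B+C^TM_fC$, and with $\tilde A_h^c=B^T\tilde M_v^{-1}B+C^TM_fC$, $$\mathcal G_h^c=\begin{pmatrix} I & \tilde M_v^{-1}B \\ 0 & I \end{pmatrix}\begin{pmatrix} -\tilde M_v & 0 \\ B^T & \tilde A_h^c \end{pmatrix}^{-1}:\ S_h'\times\boldsymbol U_h'\to S_h\times\boldsymbol U_h.$$ Div case: $\langle M_e\boldsymbol\sigma,\boldsymbol\tau\rangle=(\boldsymbol\sigma,\boldsymbol\tau)$ for $\boldsymbol\sigma,\boldsymbol\tau\in\boldsymbol U_h$; here $C:\boldsymbol U_h\to\boldsymbol V_h'$, $\langle C\boldsymbol\sigma,\boldsymbol v\rangle=(\mathrm{curl}\,\boldsymbol\sigma,\boldsymbol v)$; and $B^TM_tB:\boldsymbol V_h\to\boldsymbol V_h'$, $\langle B^TM_tB\boldsymbol u,\boldsymbol v\rangle=(\mathrm{div}\,\boldsymbol u,\mathrm{div}\,\boldsymbol v)$.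 Then $\mathcal L_h^d=\begin{pmatrix} -M_e & C^T \\ C & B^TM_tB \end{pmatrix}$, $A_h^d=CM_e^{-1}C^T+B^TM_tB$, and with $\tilde A_h^d=C\tilde M_e^{-1}C^T+B^TM_tB$, $$\mathcal G_h^d=\begin{pmatrix} I & \tilde M_e^{-1}C^T \\ 0 & I \end{pmatrix}\begin{pmatrix} -\tilde M_e & 0 \\ C & \tilde A_h^d \end{pmatrix}^{-1}:\ \boldsymbol U_h'\times\boldsymbol V_h'\to\boldsymbol U_h\times\boldsymbol V_h.$$ Here $\tilde M_v:S_h\to S_h'$ and $\tilde M_e:\boldsymbol U_h\to\boldsymbol U_h'$ are easy-to-invert approximations of the mass matrices (e.g. diagonal or lumped). Spectral equivalence of $\tilde M$ and $M$ means $c_1\langle M\sigma,\sigma\rangle\le\langle\tilde M\sigma,\sigma\rangle\le c_2\langle M\sigma,\sigma\rangle$ for all $\sigma$, with $c_1,c_2>0$ independent of $h$. With $M=M_v$, $A=A_h^c$ in the curl case and $M=M_e$, $A=A_h^d$ in the div case, $\|\sigma\|_M^2=\langle M\sigma,\sigma\rangle$ and $\|u\|_A^2=\langle Au,u\rangle$; the product space carries the product norm, e.g. $\|\sigma\|_M+\|u\|_A$. *)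

theory Defs
  imports "HOL-Analysis.Analysis"
begin

section \<open>Classical differential operators and test functions\<close>

definition partial :: "3 \<Rightarrow> (real^3 \<Rightarrow> real) \<Rightarrow> real^3 \<Rightarrow> real" where
  "partial i f x = frechet_derivative f (at x) (axis i 1)"

definition grad :: "(real^3 \<Rightarrow> real) \<Rightarrow> real^3 \<Rightarrow> real^3" where
  "grad f x = (\<chi> i. partial i f x)"

definition curl :: "(real^3 \<Rightarrow> real^3) \<Rightarrow> real^3 \<Rightarrow> real^3" where
  "curl f x = vector [partial 2 (\<lambda>y. f y $ 3) x - partial 3 (\<lambda>y. f y $ 2) x,
                      partial 3 (\<lambda>y. f y $ 1) x - partial 1 (\<lambda>y. f y $ 3) x,
                      partial 1 (\<lambda>y. f y $ 2) x - partial 2 (\<lambda>y. f y $ 1) x]"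

definition divergence :: "(real^3 \<Rightarrow> real^3) \<Rightarrow> real^3 \<Rightarrow> real" where
  "divergence f x = (\<Sum>i\<in>UNIV. partial i (\<lambda>y. f y $ i) x)"

primrec Ck :: "nat \<Rightarrow> (real^3 \<Rightarrow> real) \<Rightarrow> bool" where
  "Ck 0 f = continuous_on UNIV f"
| "Ck (Suc k) f = ((\<forall>x. f differentiable (at x)) \<and> (\<forall>i. Ck k (partial i f)))"

definition test_functions :: "(real^3) set \<Rightarrow> (real^3 \<Rightarrow> real) set" where
  "test_functions \<Omega> =
     {\<phi>. (\<forall>k. Ck k \<phi>) \<and> (\<exists>K. compact K \<and> K \<subseteq> \<Omega> \<and> (\<forall>x. x \<notin> K \<longrightarrow> \<phi> x = 0))}"

definition test_fields :: "(real^3) set \<Rightarrow> (real^3 \<Rightarrow> real^3) set" where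
  "test_fields \<Omega> = {\<phi>. \<forall>i. (\<lambda>x. \<phi> x $ i) \<in> test_functions \<Omega>}"


section \<open>Sobolev spaces\<close>

definition L2 :: "(real^3) set \<Rightarrow> (real^3 \<Rightarrow> 'b::euclidean_space) set" where
  "L2 \<Omega> = {u. u \<in> borel_measurable (lebesgue_on \<Omega>) \<and>
               integrable (lebesgue_on \<Omega>) (\<lambda>x. (norm (u x))\<^sup>2)}"

definition l2_inner ::
    "(real^3) set \<Rightarrow> (real^3 \<Rightarrow> 'b::euclidean_space) \<Rightarrow> (real^3 \<Rightarrow> 'b) \<Rightarrow> real" where
  "l2_inner \<Omega> u v = integral\<^sup>L (lebesgue_on \<Omega>) (\<lambda>x. u x \<bullet> v x)"

definition l2_norm :: "(real^3) set \<Rightarrow> (real^3 \<Rightarrow> 'b::euclidean_space) \<Rightarrow> real" where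
  "l2_norm \<Omega> u = sqrt (l2_inner \<Omega> u u)"

definition l2_tendsto ::
    "(real^3) set \<Rightarrow> (nat \<Rightarrow> real^3 \<Rightarrow> 'b::euclidean_space) \<Rightarrow> (real^3 \<Rightarrow> 'b) \<Rightarrow> bool" where
  "l2_tendsto \<Omega> \<phi> u \<longleftrightarrow> (\<lambda>n. l2_norm \<Omega> (\<lambda>x. \<phi> n x - u x)) \<longlonglongrightarrow> 0"

text \<open>Weak derivatives are determined only almost everywhere, so they are introduced as relations.\<close>

definition has_weak_grad ::
    "(real^3) set \<Rightarrow> (real^3 \<Rightarrow> real) \<Rightarrow> (real^3 \<Rightarrow> real^3) \<Rightarrow> bool" where
  "has_weak_grad \<Omega> u g \<longleftrightarrow> u \<in> L2 \<Omega> \<and> g \<in> L2 \<Omega> \<and>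
     (\<forall>\<phi>\<in>test_fields \<Omega>. l2_inner \<Omega> u (divergence \<phi>) = - l2_inner \<Omega> g \<phi>)"

definition has_weak_curl ::
    "(real^3) set \<Rightarrow> (real^3 \<Rightarrow> real^3) \<Rightarrow> (real^3 \<Rightarrow> real^3) \<Rightarrow> bool" where
  "has_weak_curl \<Omega> u w \<longleftrightarrow> u \<in> L2 \<Omega> \<and> w \<in> L2 \<Omega> \<and>
     (\<forall>\<phi>\<in>test_fields \<Omega>. l2_inner \<Omega> u (curl \<phi>) = l2_inner \<Omega> w \<phi>)"

definition has_weak_div ::
    "(real^3) set \<Rightarrow> (real^3 \<Rightarrow> real^3) \<Rightarrow> (real^3 \<Rightarrow> real) \<Rightarrow> bool" where
  "has_weak_div \<Omega> u d \<longleftrightarrow> u \<in> L2 \<Omega> \<and> d \<in> L2 \<Omega> \<and>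
     (\<forall>\<phi>\<in>test_functions \<Omega>. l2_inner \<Omega> u (grad \<phi>) = - l2_inner \<Omega> d \<phi>)"

definition weak_grad :: "(real^3) set \<Rightarrow> (real^3 \<Rightarrow> real) \<Rightarrow> real^3 \<Rightarrow> real^3" where
  "weak_grad \<Omega> u = (SOME g. has_weak_grad \<Omega> u g)"

definition weak_curl :: "(real^3) set \<Rightarrow> (real^3 \<Rightarrow> real^3) \<Rightarrow> real^3 \<Rightarrow> real^3" where
  "weak_curl \<Omega> u = (SOME w. has_weak_curl \<Omega> u w)"

definition weak_div :: "(real^3) set \<Rightarrow> (real^3 \<Rightarrow> real^3) \<Rightarrow> real^3 \<Rightarrow> real" where
  "weak_div \<Omega> u = (SOME d. has_weak_div \<Omega> u d)"

text \<open>The spaces with vanishing trace are the closures of the test functions in the graph norm.\<close>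

definition H1_0 :: "(real^3) set \<Rightarrow> (real^3 \<Rightarrow> real) set" where
  "H1_0 \<Omega> = {u. \<exists>g. has_weak_grad \<Omega> u g \<and>
     (\<exists>\<phi>. (\<forall>n::nat. \<phi> n \<in> test_functions \<Omega>) \<and>
          l2_tendsto \<Omega> \<phi> u \<and> l2_tendsto \<Omega> (\<lambda>n. grad (\<phi> n)) g)}"

definition H_curl_0 :: "(real^3) set \<Rightarrow> (real^3 \<Rightarrow> real^3) set" where
  "H_curl_0 \<Omega> = {u. \<exists>w. has_weak_curl \<Omega> u w \<and>
     (\<exists>\<phi>. (\<forall>n::nat. \<phi> n \<in> test_fields \<Omega>) \<and>
          l2_tendsto \<Omega> \<phi> u \<and> l2_tendsto \<Omega> (\<lambda>n. curl (\<phi> n)) w)}"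

definition H_div_0 :: "(real^3) set \<Rightarrow> (real^3 \<Rightarrow> real^3) set" where
  "H_div_0 \<Omega> = {u. \<exists>d. has_weak_div \<Omega> u d \<and>
     (\<exists>\<phi>. (\<forall>n::nat. \<phi> n \<in> test_fields \<Omega>) \<and>
          l2_tendsto \<Omega> \<phi> u \<and> l2_tendsto \<Omega> (\<lambda>n. divergence (\<phi> n)) d)}"

definition L2_0 :: "(real^3) set \<Rightarrow> (real^3 \<Rightarrow> real) set" where
  "L2_0 \<Omega> = {u \<in> L2 \<Omega>. integral\<^sup>L (lebesgue_on \<Omega>) u = 0}"


section \<open>Meshes\<close>

definition convex_polyhedral_domain :: "(real^3) set \<Rightarrow> bool" where
  "convex_polyhedral_domain \<Omega> \<longleftrightarrow>
     open \<Omega> \<and> \<Omega> \<noteq> {} \<and> bounded \<Omega> \<and> convex \<Omega> \<and> polyhedron (closure \<Omega>) \<and>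
     \<Omega> homeomorphic ball (0::real^3) 1"

definition mesh_size :: "(real^3) set set \<Rightarrow> real" where
  "mesh_size \<T> = Max (diameter ` \<T>)"

definition tetrahedral_mesh :: "(real^3) set \<Rightarrow> (real^3) set set \<Rightarrow> bool" where
  "tetrahedral_mesh \<Omega> \<T> \<longleftrightarrow>
     triangulation \<T> \<and> (\<forall>K\<in>\<T>. 3 simplex K) \<and> \<Union>\<T> = closure \<Omega>"

definition inradius :: "(real^3) set \<Rightarrow> real" where
  "inradius K = Sup {r. \<exists>x. cball x r \<subseteq> K}"

definition shape_regular :: "real set \<Rightarrow> (real \<Rightarrow> (real^3) set set) \<Rightarrow> bool" where
  "shape_regular H \<T> \<longleftrightarrow>
     (\<exists>\<kappa>>0. \<forall>h\<in>H. \<forall>K\<in>\<T> h. \<kappa> * diameter K \<le> inradius K)"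

definition quasi_uniform :: "real set \<Rightarrow> (real \<Rightarrow> (real^3) set set) \<Rightarrow> bool" where
  "quasi_uniform H \<T> \<longleftrightarrow> (\<exists>\<kappa>>0. \<forall>h\<in>H. \<forall>K\<in>\<T> h. \<kappa> * h \<le> diameter K)"


section \<open>Finite element spaces\<close>

definition polys :: "nat \<Rightarrow> (real^3 \<Rightarrow> real) set" where
  "polys r = {p. \<exists>a. p = (\<lambda>x. \<Sum>(i,j,k)\<in>{(i,j,k). i + j + k \<le> r}.
                              a i j k * (x$1)^i * (x$2)^j * (x$3)^k)}"

definition hom_polys :: "nat \<Rightarrow> (real^3 \<Rightarrow> real) set" where
  "hom_polys r = {p. \<exists>a. p = (\<lambda>x. \<Sum>(i,j,k)\<in>{(i,j,k). i + j + k = r}.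
                                  a i j k * (x$1)^i * (x$2)^j * (x$3)^k)}"

definition vec_polys :: "nat \<Rightarrow> (real^3 \<Rightarrow> real^3) set" where
  "vec_polys r = {p. \<forall>i. (\<lambda>x. p x $ i) \<in> polys r}"

definition vec_hom_polys :: "nat \<Rightarrow> (real^3 \<Rightarrow> real^3) set" where
  "vec_hom_polys r = {p. \<forall>i. (\<lambda>x. p x $ i) \<in> hom_polys r}"

datatype kind = First | Second

text \<open>Shape functions of degree \<open>r \<ge> 1\<close> of the edge elements (Nedelec's first and second kind)
  and of the face elements (Raviart-Thomas-Nedelec, respectively Brezzi-Douglas-Marini).\<close>

fun edge_shapes :: "kind \<Rightarrow> nat \<Rightarrow> (real^3 \<Rightarrow> real^3) set" where
  "edge_shapes First r =
     {(\<lambda>x. p x + q x) | p q. p \<in> vec_polys (r - 1) \<and> q \<in> vec_hom_polys r \<and> (\<forall>x. q x \<bullet> x = 0)}"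
| "edge_shapes Second r = vec_polys r"

fun face_shapes :: "kind \<Rightarrow> nat \<Rightarrow> (real^3 \<Rightarrow> real^3) set" where
  "face_shapes First r =
     {(\<lambda>x. p x + q x *\<^sub>R x) | p q. p \<in> vec_polys (r - 1) \<and> q \<in> hom_polys (r - 1)}"
| "face_shapes Second r = vec_polys r"

text \<open>Finite element functions are classes modulo equality almost everywhere. Each class is
  represented by its unique member that is a shape function on the interior of every cell and zero
  elsewhere, that is, on the mesh skeleton and outside the domain. With this convention a finite
  element space is a finite dimensional space of functions, and on it two functions that agree
  almost everywhere are equal.\<close>

definition piecewise ::
    "(real^3) set set \<Rightarrow> (real^3 \<Rightarrow> 'b::real_vector) set \<Rightarrow> (real^3 \<Rightarrow> 'b) set" where
  "piecewise \<T> P = {u. (\<forall>K\<in>\<T>. \<exists>p\<in>P. \<forall>x\<in>interior K. u x = p x) \<and>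
                        (\<forall>x. x \<notin> (\<Union>K\<in>\<T>. interior K) \<longrightarrow> u x = 0)}"

definition lagrange_space :: "(real^3) set \<Rightarrow> (real^3) set set \<Rightarrow> nat \<Rightarrow> (real^3 \<Rightarrow> real) set" where
  "lagrange_space \<Omega> \<T> r = piecewise \<T> (polys r) \<inter> H1_0 \<Omega>"

definition edge_space ::
    "(real^3) set \<Rightarrow> (real^3) set set \<Rightarrow> kind \<Rightarrow> nat \<Rightarrow> (real^3 \<Rightarrow> real^3) set" where
  "edge_space \<Omega> \<T> \<kappa> r = piecewise \<T> (edge_shapes \<kappa> r) \<inter> H_curl_0 \<Omega>"

definition face_space ::
    "(real^3) set \<Rightarrow> (real^3) set set \<Rightarrow> kind \<Rightarrow> nat \<Rightarrow> (real^3 \<Rightarrow> real^3) set" where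
  "face_space \<Omega> \<T> \<kappa> r = piecewise \<T> (face_shapes \<kappa> r) \<inter> H_div_0 \<Omega>"

definition dg_space :: "(real^3) set \<Rightarrow> (real^3) set set \<Rightarrow> nat \<Rightarrow> (real^3 \<Rightarrow> real) set" where
  "dg_space \<Omega> \<T> r = piecewise \<T> (polys r) \<inter> L2_0 \<Omega>"

definition exact_complex ::
    "(real^3) set \<Rightarrow> (real^3 \<Rightarrow> real) set \<Rightarrow> (real^3 \<Rightarrow> real^3) set \<Rightarrow>
     (real^3 \<Rightarrow> real^3) set \<Rightarrow> (real^3 \<Rightarrow> real) set \<Rightarrow> bool" where
  "exact_complex \<Omega> S U V W \<longleftrightarrow>
     \<comment> \<open>grad, curl and div map each space into the next one\<close>
     (\<forall>\<tau>\<in>S. \<exists>u\<in>U. has_weak_grad \<Omega> \<tau> u) \<and>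
     (\<forall>u\<in>U. \<exists>v\<in>V. has_weak_curl \<Omega> u v) \<and>
     (\<forall>v\<in>V. \<exists>w\<in>W. has_weak_div \<Omega> v w) \<and>
     \<comment> \<open>exactness at \<open>S\<close>, \<open>U\<close>, \<open>V\<close> and \<open>W\<close>\<close>
     (\<forall>\<tau>\<in>S. has_weak_grad \<Omega> \<tau> (\<lambda>_. 0) \<longrightarrow> \<tau> = (\<lambda>_. 0)) \<and>
     (\<forall>u\<in>U. has_weak_curl \<Omega> u (\<lambda>_. 0) \<longleftrightarrow> (\<exists>\<tau>\<in>S. has_weak_grad \<Omega> \<tau> u)) \<and>
     (\<forall>v\<in>V. has_weak_div \<Omega> v (\<lambda>_. 0) \<longleftrightarrow> (\<exists>u\<in>U. has_weak_curl \<Omega> u v)) \<and>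
     (\<forall>w\<in>W. \<exists>v\<in>V. has_weak_div \<Omega> v w)"


section \<open>Operators into dual spaces\<close>

text \<open>For a space \<open>X\<close> of functions, the dual space consists of the linear functionals on \<open>X\<close>,
  extended by zero outside \<open>X\<close>; the pairing of \<open>F\<close> and \<open>f\<close> is the value \<open>F f\<close>. All operators
  below are meant on their domain \<open>X\<close> only, and inverses are taken by \<^const>\<open>inv_into\<close> on it.\<close>

definition dual :: "('x \<Rightarrow> 'b::real_vector) set \<Rightarrow> (('x \<Rightarrow> 'b) \<Rightarrow> real) set" where
  "dual X = {F. (\<forall>f\<in>X. \<forall>g\<in>X. F (\<lambda>x. f x + g x) = F f + F g) \<and>
                (\<forall>c. \<forall>f\<in>X. F (\<lambda>x. c *\<^sub>R f x) = c * F f) \<and>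
                (\<forall>f. f \<notin> X \<longrightarrow> F f = 0)}"

definition form_op :: "'g set \<Rightarrow> ('f \<Rightarrow> 'g \<Rightarrow> real) \<Rightarrow> 'f \<Rightarrow> 'g \<Rightarrow> real" where
  "form_op Y a u = (\<lambda>v. if v \<in> Y then a u v else 0)"

definition transpose_op :: "'g set \<Rightarrow> ('g \<Rightarrow> 'f \<Rightarrow> real) \<Rightarrow> 'f \<Rightarrow> 'g \<Rightarrow> real" where
  "transpose_op Y B = form_op Y (\<lambda>\<sigma> v. B v \<sigma>)"

text \<open>In a saddle point system on \<open>X \<times> Y\<close> the blocks are \<open>M : X \<rightarrow> X'\<close>, \<open>R : Y \<rightarrow> X'\<close> (upper right),
  \<open>Q : X \<rightarrow> Y'\<close> (lower left, the transpose of \<open>R\<close>) and \<open>D : Y \<rightarrow> Y'\<close>.\<close>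

definition saddle_op ::
    "('f \<Rightarrow> 'f \<Rightarrow> real) \<Rightarrow> ('g \<Rightarrow> 'f \<Rightarrow> real) \<Rightarrow> ('f \<Rightarrow> 'g \<Rightarrow> real) \<Rightarrow> ('g \<Rightarrow> 'g \<Rightarrow> real) \<Rightarrow>
     'f \<times> 'g \<Rightarrow> ('f \<Rightarrow> real) \<times> ('g \<Rightarrow> real)" where
  "saddle_op M R Q D = (\<lambda>(\<sigma>, u). ((\<lambda>\<tau>. - M \<sigma> \<tau> + R u \<tau>), (\<lambda>v. Q \<sigma> v + D u v)))"

definition schur_op ::
    "'f set \<Rightarrow> ('f \<Rightarrow> 'f \<Rightarrow> real) \<Rightarrow> ('g \<Rightarrow> 'f \<Rightarrow> real) \<Rightarrow> ('f \<Rightarrow> 'g \<Rightarrow> real) \<Rightarrow>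
     ('g \<Rightarrow> 'g \<Rightarrow> real) \<Rightarrow> 'g \<Rightarrow> 'g \<Rightarrow> real" where
  "schur_op X M R Q D u = (\<lambda>v. Q (inv_into X M (R u)) v + D u v)"

definition lower_tri_op ::
    "('f \<Rightarrow> 'f \<Rightarrow> real) \<Rightarrow> ('f \<Rightarrow> 'g \<Rightarrow> real) \<Rightarrow> ('g \<Rightarrow> 'g \<Rightarrow> real) \<Rightarrow>
     'f \<times> 'g \<Rightarrow> ('f \<Rightarrow> real) \<times> ('g \<Rightarrow> real)" where
  "lower_tri_op M Q A = (\<lambda>(\<sigma>, u). ((\<lambda>\<tau>. - M \<sigma> \<tau>), (\<lambda>v. Q \<sigma> v + A u v)))"

definition upper_unit_op ::
    "('x \<Rightarrow> 'b::real_vector) set \<Rightarrow> (('x \<Rightarrow> 'b) \<Rightarrow> ('x \<Rightarrow> 'b) \<Rightarrow> real) \<Rightarrow>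
     ('g \<Rightarrow> ('x \<Rightarrow> 'b) \<Rightarrow> real) \<Rightarrow> ('x \<Rightarrow> 'b) \<times> 'g \<Rightarrow> ('x \<Rightarrow> 'b) \<times> 'g" where
  "upper_unit_op X M R = (\<lambda>(\<sigma>, u). ((\<lambda>x. \<sigma> x + inv_into X M (R u) x), u))"

definition precond_op ::
    "('x \<Rightarrow> 'b::real_vector) set \<Rightarrow> 'g set \<Rightarrow> (('x \<Rightarrow> 'b) \<Rightarrow> ('x \<Rightarrow> 'b) \<Rightarrow> real) \<Rightarrow>
     ('g \<Rightarrow> ('x \<Rightarrow> 'b) \<Rightarrow> real) \<Rightarrow> (('x \<Rightarrow> 'b) \<Rightarrow> 'g \<Rightarrow> real) \<Rightarrow> ('g \<Rightarrow> 'g \<Rightarrow> real) \<Rightarrow>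
     (('x \<Rightarrow> 'b) \<Rightarrow> real) \<times> ('g \<Rightarrow> real) \<Rightarrow> ('x \<Rightarrow> 'b) \<times> 'g" where
  "precond_op X Y Mt R Q D =
     upper_unit_op X Mt R \<circ>
     inv_into (X \<times> Y) (lower_tri_op Mt Q (schur_op X Mt R Q D))"

definition mass_op ::
    "(real^3) set \<Rightarrow> (real^3 \<Rightarrow> 'b::euclidean_space) set \<Rightarrow>
     (real^3 \<Rightarrow> 'b) \<Rightarrow> (real^3 \<Rightarrow> 'b) \<Rightarrow> real" where
  "mass_op \<Omega> X = form_op X (l2_inner \<Omega>)"


subsection \<open>The curl case\<close>

definition Bc_op ::
    "(real^3) set \<Rightarrow> (real^3 \<Rightarrow> real) set \<Rightarrow> (real^3 \<Rightarrow> real^3) \<Rightarrow> (real^3 \<Rightarrow> real) \<Rightarrow> real" where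
  "Bc_op \<Omega> S = form_op S (\<lambda>u \<tau>. l2_inner \<Omega> u (weak_grad \<Omega> \<tau>))"

definition CMC_op ::
    "(real^3) set \<Rightarrow> (real^3 \<Rightarrow> real^3) set \<Rightarrow> (real^3 \<Rightarrow> real^3) \<Rightarrow> (real^3 \<Rightarrow> real^3) \<Rightarrow> real" where
  "CMC_op \<Omega> U = form_op U (\<lambda>u v. l2_inner \<Omega> (weak_curl \<Omega> u) (weak_curl \<Omega> v))"

definition Lc_op where
  "Lc_op \<Omega> S U =
     saddle_op (mass_op \<Omega> S) (Bc_op \<Omega> S) (transpose_op U (Bc_op \<Omega> S)) (CMC_op \<Omega> U)"

definition Ac_op where
  "Ac_op \<Omega> S U =
     schur_op S (mass_op \<Omega> S) (Bc_op \<Omega> S) (transpose_op U (Bc_op \<Omega> S)) (CMC_op \<Omega> U)"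

definition Gc_op where
  "Gc_op \<Omega> S U Mt =
     precond_op S U Mt (Bc_op \<Omega> S) (transpose_op U (Bc_op \<Omega> S)) (CMC_op \<Omega> U)"


subsection \<open>The div case\<close>

definition Cd_op ::
    "(real^3) set \<Rightarrow> (real^3 \<Rightarrow> real^3) set \<Rightarrow> (real^3 \<Rightarrow> real^3) \<Rightarrow> (real^3 \<Rightarrow> real^3) \<Rightarrow> real" where
  "Cd_op \<Omega> V = form_op V (\<lambda>\<sigma> v. l2_inner \<Omega> (weak_curl \<Omega> \<sigma>) v)"

definition BMB_op ::
    "(real^3) set \<Rightarrow> (real^3 \<Rightarrow> real^3) set \<Rightarrow> (real^3 \<Rightarrow> real^3) \<Rightarrow> (real^3 \<Rightarrow> real^3) \<Rightarrow> real" where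
  "BMB_op \<Omega> V = form_op V (\<lambda>u v. l2_inner \<Omega> (weak_div \<Omega> u) (weak_div \<Omega> v))"

definition Ld_op where
  "Ld_op \<Omega> U V =
     saddle_op (mass_op \<Omega> U) (transpose_op U (Cd_op \<Omega> V)) (Cd_op \<Omega> V) (BMB_op \<Omega> V)"

definition Ad_op where
  "Ad_op \<Omega> U V =
     schur_op U (mass_op \<Omega> U) (transpose_op U (Cd_op \<Omega> V)) (Cd_op \<Omega> V) (BMB_op \<Omega> V)"

definition Gd_op where
  "Gd_op \<Omega> U V Mt =
     precond_op U V Mt (transpose_op U (Cd_op \<Omega> V)) (Cd_op \<Omega> V) (BMB_op \<Omega> V)"


section \<open>Uniform preconditioning\<close>

text \<open>Linearity of \<open>M\<close> follows from symmetry, since every \<open>M \<sigma>\<close> is a linear functional.\<close>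

definition spd_op ::
    "('x \<Rightarrow> 'b::real_vector) set \<Rightarrow> (('x \<Rightarrow> 'b) \<Rightarrow> ('x \<Rightarrow> 'b) \<Rightarrow> real) \<Rightarrow> bool" where
  "spd_op X M \<longleftrightarrow>
     (\<forall>\<sigma>\<in>X. M \<sigma> \<in> dual X) \<and>
     (\<forall>\<sigma>\<in>X. \<forall>\<tau>\<in>X. M \<sigma> \<tau> = M \<tau> \<sigma>) \<and>
     (\<forall>\<sigma>\<in>X. \<sigma> \<noteq> (\<lambda>_. 0) \<longrightarrow> 0 < M \<sigma> \<sigma>)"

definition uniformly_spectrally_equivalent ::
    "real set \<Rightarrow> (real \<Rightarrow> 'f set) \<Rightarrow> (real \<Rightarrow> 'f \<Rightarrow> 'f \<Rightarrow> real) \<Rightarrow>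
     (real \<Rightarrow> 'f \<Rightarrow> 'f \<Rightarrow> real) \<Rightarrow> bool" where
  "uniformly_spectrally_equivalent H X Mt M \<longleftrightarrow>
     (\<exists>c\<^sub>1>0. \<exists>c\<^sub>2>0. \<forall>h\<in>H. \<forall>\<sigma>\<in>X h.
        c\<^sub>1 * M h \<sigma> \<sigma> \<le> Mt h \<sigma> \<sigma> \<and> Mt h \<sigma> \<sigma> \<le> c\<^sub>2 * M h \<sigma> \<sigma>)"

definition prod_norm ::
    "('f \<Rightarrow> 'f \<Rightarrow> real) \<Rightarrow> ('g \<Rightarrow> 'g \<Rightarrow> real) \<Rightarrow> 'f \<times> 'g \<Rightarrow> real" where
  "prod_norm M A = (\<lambda>(\<sigma>, u). sqrt (M \<sigma> \<sigma>) + sqrt (A u u))"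

text \<open>The operator norm is extended real, so that an unbounded operator has norm \<open>\<infinity>\<close>.\<close>

definition op_norm :: "'z set \<Rightarrow> ('z \<Rightarrow> real) \<Rightarrow> ('z \<Rightarrow> 'z) \<Rightarrow> ereal" where
  "op_norm Z N F = (SUP z\<in>{z\<in>Z. N z \<le> 1}. ereal (N (F z)))"

definition uniform_preconditioner ::
    "real set \<Rightarrow> (real \<Rightarrow> 'z set) \<Rightarrow> (real \<Rightarrow> 'z \<Rightarrow> real) \<Rightarrow>
     (real \<Rightarrow> 'y \<Rightarrow> 'z) \<Rightarrow> (real \<Rightarrow> 'z \<Rightarrow> 'y) \<Rightarrow> bool" where
  "uniform_preconditioner H Z N G L \<longleftrightarrow>
     (\<exists>c::real. \<forall>h\<in>H.
        bij_betw (G h \<circ> L h) (Z h) (Z h) \<and>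
        op_norm (Z h) (N h) (G h \<circ> L h) \<le> ereal c \<and>
        op_norm (Z h) (N h) (inv_into (Z h) (G h \<circ> L h)) \<le> ereal c)"

end

theory Submission
  imports Defs "HOL-Library.Function_Algebras"
begin

text \<open>
  Both halves of the theorem are instances of one algebraic fact about saddle point systems.
  Write \<open>L\<^sub>M\<close> for the saddle point operator with the mass operator \<open>M\<close> in its upper left block.
  Block elimination shows that the preconditioner built from another mass operator \<open>M'\<close> is
  exactly the inverse of \<open>L\<^sub>M\<^sub>'\<close> (lemma \<open>precond_saddle\<close>). The preconditioned operator is thus
  \<open>L\<^sub>M\<^sub>'\<close> inverted and applied to \<open>L\<^sub>M\<close>, and its inverse is the same expression with \<open>M\<close> and
  \<open>M'\<close> exchanged. One estimate therefore bounds both norms: if \<open>L\<^sub>M\<^sub>' w = L\<^sub>M z\<close>, then the norm of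
  \<open>w\<close> with respect to \<open>M'\<close> is at most a constant times the norm of \<open>z\<close> with respect to \<open>M\<close>
  (lemma \<open>stability\<close>), where the constant depends only on the spectral equivalence. Passing
  from the norm of \<open>M'\<close> to the norm of \<open>M\<close> costs another such constant (lemma \<open>N_le\<close>), because
  the Schur complement \<open>A\<close> has the energy \<open>\<parallel>M\<inverse> B u\<parallel>\<^sup>2 + \<langle>D u, u\<rangle>\<close>, whose first term is the
  square of a dual norm and reacts to a change of the mass operator in a controlled way.

  The algebra presupposes that \<open>M\<close> and \<open>A\<close> are isomorphisms onto the dual spaces. This holds for
  every symmetric positive definite operator on a finite dimensional space
  (lemma \<open>spd_op_bij_dual\<close>). For \<open>A\<close>, definiteness is where exactness of the discrete complex
  enters: if \<open>\<langle>A u, u\<rangle> = 0\<close>, then \<open>u\<close> lies in the kernel of curl (or div), so that it is a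
  gradient (or a curl) of some discrete \<open>\<tau>\<close>; since also \<open>B u = 0\<close>, it is orthogonal to all such
  fields and hence to itself (lemma \<open>complex_saddle_system\<close>).

  The analytic part justifies that the operators are what they seem to be. Weak derivatives are
  picked by a choice operator, so that even their linearity rests on uniqueness almost
  everywhere, that is, on the fundamental lemma of the calculus of variations
  (lemma \<open>AE_zero_of_test_functions\<close>); it is proved with explicit smooth bumps on boxes. Finally,
  the finite element spaces are shown to be finite dimensional linear spaces on which a function
  that vanishes almost everywhere is zero.
\<close>

section \<open>Finite dimensional function spaces and their duals\<close>

definition fscale :: "real \<Rightarrow> ('x \<Rightarrow> 'b::real_vector) \<Rightarrow> 'x \<Rightarrow> 'b" where
  "fscale c f = (\<lambda>x. c *\<^sub>R f x)"

text \<open>Functions carry pointwise addition as type class structure; together with \<open>fscale\<close> this makes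
  spans, independence and dimension bounds of the abstract theory of vector spaces available
  for function spaces.\<close>

interpretation fn: vector_space fscale
  by unfold_locales (auto simp: fscale_def plus_fun_def scaleR_add_right scaleR_add_left)

definition finite_dim_space :: "('x \<Rightarrow> 'b::real_vector) set \<Rightarrow> bool" where
  "finite_dim_space X \<longleftrightarrow> fn.subspace X \<and> (\<exists>B. finite B \<and> X \<subseteq> fn.span B)"

lemma dual_iff:
  "F \<in> dual X \<longleftrightarrow> (\<forall>f\<in>X. \<forall>g\<in>X. F (f + g) = F f + F g) \<and>
     (\<forall>c. \<forall>f\<in>X. F (fscale c f) = c * F f) \<and> (\<forall>f. f \<notin> X \<longrightarrow> F f = 0)"
  by (simp add: dual_def fscale_def plus_fun_def)

lemma dual_add: "F \<in> dual X \<Longrightarrow> f \<in> X \<Longrightarrow> g \<in> X \<Longrightarrow> F (f + g) = F f + F g"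
  and dual_scale: "F \<in> dual X \<Longrightarrow> f \<in> X \<Longrightarrow> F (fscale c f) = c * F f"
  and dual_outside: "F \<in> dual X \<Longrightarrow> f \<notin> X \<Longrightarrow> F f = 0"
  by (auto simp: dual_iff)

lemma fscale_minus: "fscale (-1) f = - f"
  by (simp add: fscale_def fun_eq_iff)

lemma dual_diff:
  assumes "F \<in> dual X" "fn.subspace X" "f \<in> X" "g \<in> X"
  shows "F (f - g) = F f - F g"
proof -
  have "F (f + fscale (-1) g) = F f + F (fscale (-1) g)"
    using assms by (intro dual_add fn.subspace_scale)
  then show ?thesis
    using assms dual_scale[of F X g "-1"] by (simp add: fscale_minus)
qed

lemma dual_sum:
  assumes "F \<in> dual X" "fn.subspace X" "finite E" "\<And>e. e \<in> E \<Longrightarrow> f e \<in> X"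
  shows "F (\<Sum>e\<in>E. f e) = (\<Sum>e\<in>E. F (f e))"
  using assms(3,4)
proof (induction E rule: finite_induct)
  case empty
  have "F (fscale 0 0) = 0 * F 0"
    using assms(1) fn.subspace_0[OF assms(2)] by (rule dual_scale)
  then show ?case by (simp add: zero_fun_def)
next
  case (insert a E)
  have "F (f a + sum f E) = F (f a) + F (sum f E)"
    using insert assms by (intro dual_add) (auto intro: fn.subspace_sum)
  with insert show ?case by (simp only: sum.insert insert_iff simp_thms)
qed

lemma dual_combine:
  assumes "F \<in> dual X" "G \<in> dual X"
  shows "(\<lambda>f. a * F f + b * G f) \<in> dual X"
  using assms by (auto simp: dual_iff algebra_simps)

lemma dual_plus: "F \<in> dual X \<Longrightarrow> G \<in> dual X \<Longrightarrow> (\<lambda>f. F f + G f) \<in> dual X"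
  using dual_combine[of F X G 1 1] by simp

lemma dual_minus: "F \<in> dual X \<Longrightarrow> G \<in> dual X \<Longrightarrow> (\<lambda>f. F f - G f) \<in> dual X"
  using dual_combine[of F X G 1 "-1"] by simp

lemma dual_uminus: "F \<in> dual X \<Longrightarrow> (\<lambda>f. - F f) \<in> dual X"
  using dual_combine[of F X F "-1" 0] by simp

text \<open>The hypotheses of \<open>spd_op\<close> with definiteness weakened to nonnegativity, as satisfied by the
  curl-curl and div-div blocks.\<close>

definition psd_op ::
    "('x \<Rightarrow> 'b::real_vector) set \<Rightarrow> (('x \<Rightarrow> 'b) \<Rightarrow> ('x \<Rightarrow> 'b) \<Rightarrow> real) \<Rightarrow> bool" where
  "psd_op X M \<longleftrightarrow> (\<forall>\<sigma>\<in>X. M \<sigma> \<in> dual X) \<and> (\<forall>\<sigma>\<in>X. \<forall>\<tau>\<in>X. M \<sigma> \<tau> = M \<tau> \<sigma>) \<and>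
     (\<forall>\<sigma>\<in>X. 0 \<le> M \<sigma> \<sigma>)"

lemma spd_op_iff: "spd_op X M \<longleftrightarrow> psd_op X M \<and> (\<forall>\<sigma>\<in>X. M \<sigma> \<sigma> = 0 \<longrightarrow> \<sigma> = 0)"
  if X: "fn.subspace X"
proof
  assume s: "spd_op X M"
  have pos: "0 < M \<sigma> \<sigma>" if "\<sigma> \<in> X" "\<sigma> \<noteq> 0" for \<sigma>
    using s that by (simp add: spd_op_def zero_fun_def)
  have "M 0 \<in> dual X" using s fn.subspace_0[OF X] unfolding spd_op_def by blast
  from dual_scale[OF this fn.subspace_0[OF X], of 0] have "M 0 0 = 0" by simp
  then have "0 \<le> M \<sigma> \<sigma>" if "\<sigma> \<in> X" for \<sigma>
    using pos[OF that] by (cases "\<sigma> = 0") auto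
  moreover have "\<sigma> = 0" if "\<sigma> \<in> X" "M \<sigma> \<sigma> = 0" for \<sigma>
    using pos[OF that(1)] that(2) by fastforce
  ultimately show "psd_op X M \<and> (\<forall>\<sigma>\<in>X. M \<sigma> \<sigma> = 0 \<longrightarrow> \<sigma> = 0)"
    using s unfolding spd_op_def psd_op_def by blast
next
  assume p: "psd_op X M \<and> (\<forall>\<sigma>\<in>X. M \<sigma> \<sigma> = 0 \<longrightarrow> \<sigma> = 0)"
  have "0 < M \<sigma> \<sigma>" if "\<sigma> \<in> X" "\<sigma> \<noteq> (\<lambda>_. 0)" for \<sigma>
  proof -
    have "M \<sigma> \<sigma> \<noteq> 0" using p that by (auto simp: zero_fun_def)
    moreover have "0 \<le> M \<sigma> \<sigma>" using p that by (simp add: psd_op_def)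
    ultimately show ?thesis by simp
  qed
  then show "spd_op X M" using p unfolding spd_op_def psd_op_def by simp
qed

lemma psd_dual: "psd_op X M \<Longrightarrow> f \<in> X \<Longrightarrow> M f \<in> dual X"
  and psd_sym: "psd_op X M \<Longrightarrow> f \<in> X \<Longrightarrow> g \<in> X \<Longrightarrow> M f g = M g f"
  and psd_nonneg: "psd_op X M \<Longrightarrow> f \<in> X \<Longrightarrow> 0 \<le> M f f"
  by (auto simp: psd_op_def)

text \<open>Symmetry is assumed on \<open>X\<close> only. Functionals in the dual vanish outside \<open>X\<close>, which extends
  the exchange of arguments to arbitrary \<open>t\<close>, and linearity of \<open>M\<close> in its first argument then
  follows from linearity in the second.\<close>

lemma psd_commute:
  assumes M: "psd_op X M" and "f \<in> X"
  shows "M f t = (if t \<in> X then M t f else 0)"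
  using assms psd_sym[OF M, of f t] dual_outside[OF psd_dual[OF M, of f], of t] by simp

lemma psd_add_left:
  assumes M: "psd_op X M" and X: "fn.subspace X" and f: "f \<in> X" and g: "g \<in> X"
  shows "M (f + g) = (\<lambda>t. M f t + M g t)"
proof
  fix t
  show "M (f + g) t = M f t + M g t"
    using psd_commute[OF M fn.subspace_add[OF X f g], of t] psd_commute[OF M f, of t] psd_commute[OF M g, of t]
      dual_add[OF psd_dual[OF M, of t] f g] by (simp split: if_splits)
qed

lemma psd_scale_left:
  assumes M: "psd_op X M" and X: "fn.subspace X" and f: "f \<in> X"
  shows "M (fscale c f) = (\<lambda>t. c * M f t)"
proof
  fix t
  show "M (fscale c f) t = c * M f t"
    using psd_commute[OF M fn.subspace_scale[OF X f], of c t] psd_commute[OF M f, of t]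
      dual_scale[OF psd_dual[OF M, of t] f, of c] by (simp split: if_splits)
qed

lemma psd_diff_left:
  assumes M: "psd_op X M" and X: "fn.subspace X" and f: "f \<in> X" and g: "g \<in> X"
  shows "M (f - g) = (\<lambda>t. M f t - M g t)"
proof
  fix t
  show "M (f - g) t = M f t - M g t"
    using psd_commute[OF M fn.subspace_diff[OF X f g], of t] psd_commute[OF M f, of t] psd_commute[OF M g, of t]
      dual_diff[OF psd_dual[OF M, of t] X f g] by (simp split: if_splits)
qed

text \<open>The core of every Cauchy-Schwarz inequality: evaluate the quadratic at its minimum.\<close>

lemma nonneg_quadratic_discriminant:
  fixes a b c :: real
  assumes nonneg: "\<And>t. 0 \<le> a + 2 * t * b + t\<^sup>2 * c" and "0 \<le> c"
  shows "\<bar>b\<bar> \<le> sqrt a * sqrt c"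
proof -
  have "b\<^sup>2 \<le> a * c"
  proof (cases "c = 0")
    case True
    \<comment> \<open>An affine function that stays nonnegative is constant.\<close>
    have "b = 0"
    proof (rule ccontr)
      assume "b \<noteq> 0"
      with True nonneg[of "- (a + 1) / (2 * b)"] show False by (simp add: field_simps)
    qed
    with True show ?thesis by simp
  next
    case False
    with \<open>0 \<le> c\<close> nonneg[of "- b / c"] show ?thesis
      by (simp add: field_simps power2_eq_square)
  qed
  then have "sqrt (b\<^sup>2) \<le> sqrt (a * c)" by (rule real_sqrt_le_mono)
  then show ?thesis by (simp add: real_sqrt_mult)
qed

lemma psd_Cauchy_Schwarz:
  assumes M: "psd_op X M" and X: "fn.subspace X" and f: "f \<in> X" and g: "g \<in> X"
  shows "\<bar>M f g\<bar> \<le> sqrt (M f f) * sqrt (M g g)"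
proof (rule nonneg_quadratic_discriminant)
  fix t :: real
  have tg: "fscale t g \<in> X" using X g by (rule fn.subspace_scale)
  have "0 \<le> M (f + fscale t g) (f + fscale t g)"
    by (intro psd_nonneg[OF M] fn.subspace_add[OF X] f tg)
  also have "\<dots> = M f (f + fscale t g) + t * M g (f + fscale t g)"
    by (simp add: psd_add_left[OF M X f tg] psd_scale_left[OF M X g])
  also have "\<dots> = M f f + t * M f g + t * (M g f + t * M g g)"
    using dual_add[OF psd_dual[OF M f] f tg] dual_add[OF psd_dual[OF M g] f tg]
      dual_scale[OF psd_dual[OF M f] g] dual_scale[OF psd_dual[OF M g] g] by simp
  also have "\<dots> = M f f + 2 * t * M f g + t\<^sup>2 * M g g"
    using psd_sym[OF M f g] by (simp add: algebra_simps power2_eq_square)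
  finally show "0 \<le> M f f + 2 * t * M f g + t\<^sup>2 * M g g" .
qed (use psd_nonneg[OF M g] in auto)

lemma orthonormal_independent:
  assumes M: "psd_op X M" and X: "fn.subspace X" and E: "E \<subseteq> X"
    and on: "\<And>e e'. e \<in> E \<Longrightarrow> e' \<in> E \<Longrightarrow> M e e' = (if e = e' then 1 else 0)"
  shows "fn.independent E"
  unfolding fn.independent_explicit_finite_subsets
proof (intro allI impI ballI)
  fix A u v
  assume A: "A \<subseteq> E" "finite A" and s: "(\<Sum>v\<in>A. fscale (u v) v) = 0" and v: "v \<in> A"
  have vX: "v \<in> X" and AX: "A \<subseteq> X" using A v E by auto
  have "M v (\<Sum>w\<in>A. fscale (u w) w) = (\<Sum>w\<in>A. M v (fscale (u w) w))"
    using AX by (intro dual_sum[OF psd_dual[OF M vX] X \<open>finite A\<close>] fn.subspace_scale[OF X]) auto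
  also have "\<dots> = (\<Sum>w\<in>A. u w * (if v = w then 1 else 0))"
  proof (intro sum.cong refl)
    fix w assume "w \<in> A"
    then have "w \<in> X" "w \<in> E" "v \<in> E" using A v AX by auto
    then show "M v (fscale (u w) w) = u w * (if v = w then 1 else 0)"
      by (simp add: dual_scale[OF psd_dual[OF M vX]] on)
  qed
  also have "\<dots> = u v" using A v by (simp add: if_distrib cong: if_cong)
  finally show "u v = 0"
    using s dual_scale[OF psd_dual[OF M vX], of 0 0] X by (simp add: fn.subspace_0)
qed

text \<open>Orthonormal subsets of \<open>X\<close> are independent, so their size is bounded. One of maximal size
  spans: otherwise the normalised residual of a projection could be added to it.\<close>

lemma spd_orthonormal_basis:
  assumes M: "spd_op X M" and X: "finite_dim_space X"
  obtains E where "finite E" "E \<subseteq> X" "\<And>f. f \<in> X \<Longrightarrow> f = (\<Sum>e\<in>E. fscale (M e f) e)"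
proof -
  have sub: "fn.subspace X" using X by (simp add: finite_dim_space_def)
  obtain B where B: "finite B" "X \<subseteq> fn.span B" using X by (auto simp: finite_dim_space_def)
  have psd: "psd_op X M" and zero: "\<And>f. f \<in> X \<Longrightarrow> M f f = 0 \<Longrightarrow> f = 0"
    using M by (auto simp: spd_op_iff[OF sub])
  define ON where
    "ON E \<longleftrightarrow> E \<subseteq> X \<and> (\<forall>e\<in>E. \<forall>e'\<in>E. M e e' = (if e = e' then 1 else 0))" for E
  have bound: "finite E \<and> card E \<le> card B" if "ON E" for E
    using that B by (intro fn.independent_span_bound orthonormal_independent[OF psd sub])
      (auto simp: ON_def)
  have "ON {}" by (simp add: ON_def)
  moreover have "\<forall>E. ON E \<longrightarrow> card E < Suc (card B)" using bound by (simp add: less_Suc_eq_le)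
  ultimately have "\<exists>E. ON E \<and> (\<forall>E'. ON E' \<longrightarrow> card E' \<le> card E)"
    by (rule Lattices_Big.ex_has_greatest_nat)
  then obtain E where E: "ON E" and max: "\<And>E'. ON E' \<Longrightarrow> card E' \<le> card E"
    by metis
  have fin: "finite E" using bound E by blast
  have EX: "E \<subseteq> X" using E by (simp add: ON_def)
  have "f = (\<Sum>e\<in>E. fscale (M e f) e)" if f: "f \<in> X" for f
  proof -
    define p where "p = (\<Sum>e\<in>E. fscale (M e f) e)"
    define g where "g = f - p"
    have pX: "p \<in> X"
      unfolding p_def using EX by (intro fn.subspace_sum[OF sub] fn.subspace_scale[OF sub]) auto
    have gX: "g \<in> X" unfolding g_def using sub f pX by (rule fn.subspace_diff)
    have orth: "M e g = 0" if e: "e \<in> E" for e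
    proof -
      have eX: "e \<in> X" using e EX by auto
      have "M e p = (\<Sum>w\<in>E. M e (fscale (M w f) w))"
        unfolding p_def using EX
        by (intro dual_sum[OF psd_dual[OF psd eX] sub fin] fn.subspace_scale[OF sub]) auto
      also have "\<dots> = (\<Sum>w\<in>E. M w f * (if e = w then 1 else 0))"
      proof (intro sum.cong refl)
        fix w assume w: "w \<in> E"
        then have "w \<in> X" using EX by auto
        moreover have "M e w = (if e = w then 1 else 0)" using E e w by (simp add: ON_def)
        ultimately show "M e (fscale (M w f) w) = M w f * (if e = w then 1 else 0)"
          by (simp add: dual_scale[OF psd_dual[OF psd eX]])
      qed
      also have "\<dots> = M e f" using fin e by (simp add: if_distrib cong: if_cong)
      finally show ?thesis
        unfolding g_def using dual_diff[OF psd_dual[OF psd eX] sub f pX] by simp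
    qed
    have "g = 0"
    proof (rule ccontr)
      assume "g \<noteq> 0"
      then have pos: "0 < M g g" using zero[OF gX] psd_nonneg[OF psd gX] by fastforce
      define n where "n = fscale (1 / sqrt (M g g)) g"
      have nX: "n \<in> X" unfolding n_def using sub gX by (rule fn.subspace_scale)
      have en: "M e n = 0" if "e \<in> E" for e
        using that EX orth dual_scale[OF psd_dual[OF psd] gX] by (auto simp: n_def)
      have ne: "M n e = 0" if "e \<in> E" for e
        using that en EX psd_sym[OF psd nX] by auto
      have nn: "M n n = 1"
        using pos psd_scale_left[OF psd sub gX] dual_scale[OF psd_dual[OF psd gX] gX]
        by (simp add: n_def)
      have "ON (insert n E)"
        using E nX nn en ne by (auto simp: ON_def)
      moreover have "n \<notin> E" using nn en by force
      ultimately show False using max[of "insert n E"] fin by simp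
    qed
    then show ?thesis by (simp add: g_def p_def)
  qed
  with that fin EX show ?thesis by blast
qed

text \<open>The Riesz representation theorem: the functional \<open>F\<close> is represented by \<open>\<Sum>\<^sub>e F e e\<close>, summed over
  an orthonormal basis.\<close>

lemma spd_op_bij_dual:
  assumes M: "spd_op X M" and X: "finite_dim_space X"
  shows "bij_betw M X (dual X)"
proof -
  have sub: "fn.subspace X" using X by (simp add: finite_dim_space_def)
  have psd: "psd_op X M" and zero: "\<And>f. f \<in> X \<Longrightarrow> M f f = 0 \<Longrightarrow> f = 0"
    using M by (auto simp: spd_op_iff[OF sub])
  have "inj_on M X"
  proof (rule inj_onI)
    fix f g assume f: "f \<in> X" and g: "g \<in> X" and eq: "M f = M g"
    have "M (f - g) = (\<lambda>t. 0)" using psd_diff_left[OF psd sub f g] eq by simp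
    then have "f - g = 0" using fn.subspace_diff[OF sub f g] by (intro zero) auto
    then show "f = g" by simp
  qed
  moreover have "F \<in> M ` X" if F: "F \<in> dual X" for F
  proof -
    obtain E where E: "finite E" "E \<subseteq> X" "\<And>f. f \<in> X \<Longrightarrow> f = (\<Sum>e\<in>E. fscale (M e f) e)"
      using spd_orthonormal_basis[OF M X] by metis
    define r where "r = (\<Sum>e\<in>E. fscale (F e) e)"
    have rX: "r \<in> X"
      unfolding r_def using E by (intro fn.subspace_sum[OF sub] fn.subspace_scale[OF sub]) auto
    have "M r f = F f" for f
    proof (cases "f \<in> X")
      case f: True
      have "M r f = M f r" using psd_sym[OF psd rX f] .
      also have "\<dots> = (\<Sum>e\<in>E. M f (fscale (F e) e))"
        unfolding r_def using E
        by (intro dual_sum[OF psd_dual[OF psd f] sub] fn.subspace_scale[OF sub]) auto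
      also have "\<dots> = (\<Sum>e\<in>E. F (fscale (M e f) e))"
      proof (intro sum.cong refl)
        fix e assume "e \<in> E"
        then have e: "e \<in> X" using E by auto
        show "M f (fscale (F e) e) = F (fscale (M e f) e)"
          using dual_scale[OF psd_dual[OF psd f] e] dual_scale[OF F e] psd_sym[OF psd f e] by simp
      qed
      also have "\<dots> = F (\<Sum>e\<in>E. fscale (M e f) e)"
        using E by (intro dual_sum[OF F sub, symmetric] fn.subspace_scale[OF sub]) auto
      also have "\<dots> = F f" using E(3)[OF f] by simp
      finally show ?thesis .
    next
      case False
      then show ?thesis using dual_outside[OF F] dual_outside[OF psd_dual[OF psd rX]] by simp
    qed
    then have "F = M r" by (intro ext) simp
    then show ?thesis using rX by blast
  qed
  ultimately show ?thesis
    using psd_dual[OF psd] by (auto simp: bij_betw_def)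
qed

section \<open>Saddle point systems\<close>

text \<open>Cancels a norm from an estimate of its square.\<close>

lemma le_of_sq_le_mult:
  fixes x y :: real
  assumes "x * x \<le> x * y" "0 \<le> y" shows "x \<le> y"
proof (cases "0 < x")
  case True
  then show ?thesis using mult_left_le_imp_le[OF assms(1)] by simp
qed (use assms(2) in simp)

text \<open>The blocks of the system apart from the mass operator. The last assumption is the one that
  makes the Schur complement definite: only zero has neither \<open>D\<close>-energy nor an image under \<open>R\<close>.\<close>

locale saddle_system =
  fixes X :: "('x \<Rightarrow> 'b::real_vector) set" and Y :: "('y \<Rightarrow> 'c::real_vector) set"
    and R :: "('y \<Rightarrow> 'c) \<Rightarrow> ('x \<Rightarrow> 'b) \<Rightarrow> real" and Q :: "('x \<Rightarrow> 'b) \<Rightarrow> ('y \<Rightarrow> 'c) \<Rightarrow> real"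
    and D :: "('y \<Rightarrow> 'c) \<Rightarrow> ('y \<Rightarrow> 'c) \<Rightarrow> real"
  assumes X_fin: "finite_dim_space X" and Y_fin: "finite_dim_space Y"
    and R_dual: "u \<in> Y \<Longrightarrow> R u \<in> dual X"
    and Q_dual: "\<sigma> \<in> X \<Longrightarrow> Q \<sigma> \<in> dual Y"
    and Q_transpose: "\<sigma> \<in> X \<Longrightarrow> u \<in> Y \<Longrightarrow> Q \<sigma> u = R u \<sigma>"
    and D_psd: "psd_op Y D"
    and definite: "u \<in> Y \<Longrightarrow> D u u = 0 \<Longrightarrow> (\<And>\<tau>. \<tau> \<in> X \<Longrightarrow> R u \<tau> = 0) \<Longrightarrow> u = 0"
begin

lemma X_sub: "fn.subspace X" and Y_sub: "fn.subspace Y"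
  using X_fin Y_fin by (auto simp: finite_dim_space_def)

end

locale saddle_mass = saddle_system +
  fixes M
  assumes M_spd: "spd_op X M"
begin

lemma M_psd: "psd_op X M" and M_definite: "\<sigma> \<in> X \<Longrightarrow> M \<sigma> \<sigma> = 0 \<Longrightarrow> \<sigma> = 0"
  using M_spd by (auto simp: spd_op_iff[OF X_sub])

text \<open>\<open>T u\<close> is the discrete codifferential of \<open>u\<close>, \<open>A\<close> the discrete Hodge Laplacian and \<open>N\<close> the norm
  of the product space; all three depend on the mass operator.\<close>

abbreviation T where "T u \<equiv> inv_into X M (R u)"
abbreviation A where "A \<equiv> schur_op X M R Q D"
abbreviation N where "N \<equiv> prod_norm M A"

lemma M_inv:
  assumes "F \<in> dual X"
  shows "inv_into X M F \<in> X" "M (inv_into X M F) = F"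
proof -
  have "F \<in> M ` X" using spd_op_bij_dual[OF M_spd X_fin] assms by (simp add: bij_betw_def)
  then show "inv_into X M F \<in> X" "M (inv_into X M F) = F"
    by (rule inv_into_into, rule f_inv_into_f)
qed

lemma M_inj: "\<sigma> \<in> X \<Longrightarrow> \<tau> \<in> X \<Longrightarrow> M \<sigma> = M \<tau> \<Longrightarrow> \<sigma> = \<tau>"
  using bij_betw_imp_inj_on[OF spd_op_bij_dual[OF M_spd X_fin]] by (rule inj_onD)

lemma T_in: "u \<in> Y \<Longrightarrow> T u \<in> X" and M_T: "u \<in> Y \<Longrightarrow> M (T u) = R u"
  by (intro M_inv R_dual; assumption)+

text \<open>The energy identity: the Schur complement is the sum of the codifferential part and \<open>D\<close>.\<close>

lemma A_eq:
  assumes u: "u \<in> Y" and v: "v \<in> Y"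
  shows "A u v = M (T u) (T v) + D u v"
proof -
  have "Q (T u) v = M (T v) (T u)" by (simp add: Q_transpose T_in M_T u v)
  also have "\<dots> = M (T u) (T v)" by (intro psd_sym[OF M_psd] T_in u v)
  finally show ?thesis by (simp add: schur_op_def)
qed

lemma A_dual: "u \<in> Y \<Longrightarrow> A u \<in> dual Y"
  unfolding schur_op_def by (intro dual_plus Q_dual T_in psd_dual[OF D_psd])

lemma A_diag: "u \<in> Y \<Longrightarrow> A u u = M (T u) (T u) + D u u"
  by (rule A_eq)

lemma A_spd: "spd_op Y A"
  unfolding spd_op_iff[OF Y_sub]
proof (intro conjI ballI impI)
  show "psd_op Y A"
    unfolding psd_op_def
  proof (intro conjI ballI)
    fix u v assume u: "u \<in> Y"
    show "A u \<in> dual Y" using u by (rule A_dual)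
    show "0 \<le> A u u"
      using psd_nonneg[OF M_psd T_in[OF u]] psd_nonneg[OF D_psd u] by (simp add: A_diag u)
    assume v: "v \<in> Y"
    show "A u v = A v u"
      using psd_sym[OF M_psd T_in[OF u] T_in[OF v]] psd_sym[OF D_psd u v]
      by (simp add: A_eq u v)
  qed
  fix u assume u: "u \<in> Y" and "A u u = 0"
  then have "M (T u) (T u) = 0" and D0: "D u u = 0"
    using psd_nonneg[OF M_psd T_in[OF u]] psd_nonneg[OF D_psd u] by (auto simp: A_diag)
  then have T0: "T u = 0" using M_definite T_in[OF u] by blast
  show "u = 0"
  proof (rule definite[OF u D0])
    fix \<tau> assume \<tau>: "\<tau> \<in> X"
    have "R u \<tau> = M (T u) \<tau>" by (simp add: M_T u)
    also have "\<dots> = M \<tau> 0"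
      using psd_sym[OF M_psd T_in[OF u] \<tau>] T0 by simp
    also have "\<dots> = 0"
      using dual_scale[OF psd_dual[OF M_psd \<tau>] fn.subspace_0[OF X_sub], of 0] by simp
    finally show "R u \<tau> = 0" .
  qed
qed

lemma A_psd: "psd_op Y A"
  using A_spd by (simp add: spd_op_iff[OF Y_sub])

lemma saddle_in_dual:
  assumes "z \<in> X \<times> Y"
  shows "saddle_op M R Q D z \<in> dual X \<times> dual Y"
  using assms by (auto simp: saddle_op_def intro!: dual_plus dual_minus R_dual Q_dual
      psd_dual[OF M_psd] psd_dual[OF D_psd])

lemma lower_tri_inj: "inj_on (lower_tri_op M Q A) (X \<times> Y)"
proof (rule inj_onI, clarify)
  fix \<sigma> u \<tau> v
  assume \<sigma>: "\<sigma> \<in> X" and u: "u \<in> Y" and \<tau>: "\<tau> \<in> X" and v: "v \<in> Y"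
    and eq: "lower_tri_op M Q A (\<sigma>, u) = lower_tri_op M Q A (\<tau>, v)"
  have "M \<sigma> = M \<tau>" using eq by (auto simp: lower_tri_op_def fun_eq_iff)
  then have st: "\<sigma> = \<tau>" using \<sigma> \<tau> M_inj by blast
  have Auv: "A u = A v" using eq unfolding st by (simp add: lower_tri_op_def fun_eq_iff)
  have "u = v"
    by (rule inj_onD[OF bij_betw_imp_inj_on[OF spd_op_bij_dual[OF A_spd Y_fin]] Auv u v])
  with st show "\<sigma> = \<tau> \<and> u = v" by simp
qed

text \<open>Block elimination. In the variables \<open>(p - T q, q)\<close> the saddle point operator becomes the
  lower triangular operator with the Schur complement \<open>A\<close> on its diagonal, and the upper unit
  triangular factor of the preconditioner undoes the change of variables.\<close>

lemma precond_saddle: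
  assumes z: "z \<in> X \<times> Y"
  shows "precond_op X Y M R Q D (saddle_op M R Q D z) = z"
proof -
  obtain p q where zpq: "z = (p, q)" and p: "p \<in> X" and q: "q \<in> Y" using z by auto
  define s where "s = p - T q"
  have s: "s \<in> X" unfolding s_def by (intro fn.subspace_diff[OF X_sub] p T_in q)
  have "saddle_op M R Q D z = lower_tri_op M Q A (s, q)"
  proof -
    have "M s = (\<lambda>t. M p t - R q t)"
      by (simp add: s_def psd_diff_left[OF M_psd X_sub] p T_in q M_T)
    moreover have "Q p v = Q s v + Q (T q) v" for v
    proof (cases "v \<in> Y")
      case True
      have "R v s = R v p - R v (T q)"
        unfolding s_def by (rule dual_diff[OF R_dual[OF True] X_sub p T_in[OF q]])
      then show ?thesis by (simp add: Q_transpose True p s T_in q)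
    next
      case False
      then show ?thesis
        by (simp add: dual_outside[OF Q_dual[OF p]] dual_outside[OF Q_dual[OF s]]
            dual_outside[OF Q_dual[OF T_in[OF q]]])
    qed
    ultimately show ?thesis
      by (simp add: zpq saddle_op_def lower_tri_op_def schur_op_def add.assoc)
  qed
  then have "inv_into (X \<times> Y) (lower_tri_op M Q A) (saddle_op M R Q D z) = (s, q)"
    using inv_into_f_f[OF lower_tri_inj, of "(s, q)"] s q by simp
  moreover have "(\<lambda>x. s x + T q x) = p"
    by (simp add: s_def fun_eq_iff)
  ultimately show ?thesis
    by (simp add: precond_op_def upper_unit_op_def zpq)
qed

lemma saddle_surj:
  assumes w: "w \<in> dual X \<times> dual Y"
  obtains z where "z \<in> X \<times> Y" "saddle_op M R Q D z = w"
proof -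
  obtain F G where wFG: "w = (F, G)" and F: "F \<in> dual X" and G: "G \<in> dual Y" using w by auto
  define s where "s = inv_into X M (\<lambda>\<tau>. - F \<tau>)"
  have s: "s \<in> X" and Ms: "M s = (\<lambda>\<tau>. - F \<tau>)"
    using M_inv[OF dual_uminus[OF F]] by (auto simp: s_def)
  have "(\<lambda>v. G v - Q s v) \<in> dual Y" by (intro dual_minus G Q_dual s)
  then have "(\<lambda>v. G v - Q s v) \<in> A ` Y"
    using bij_betw_imp_surj_on[OF spd_op_bij_dual[OF A_spd Y_fin]] by simp
  then obtain q where q: "q \<in> Y" and Aq: "A q = (\<lambda>v. G v - Q s v)"
    by (elim imageE) simp
  have p: "s + T q \<in> X" by (intro fn.subspace_add[OF X_sub] s T_in q)
  have "M (s + T q) = (\<lambda>\<tau>. - F \<tau> + R q \<tau>)"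
    by (simp add: psd_add_left[OF M_psd X_sub] s T_in q Ms M_T)
  moreover have "Q (s + T q) v + D q v = G v" for v
  proof (cases "v \<in> Y")
    case True
    have "R v (s + T q) = R v s + R v (T q)"
      by (rule dual_add[OF R_dual[OF True] s T_in[OF q]])
    with fun_cong[OF Aq, of v] show ?thesis
      by (simp add: schur_op_def Q_transpose True p s T_in q)
  next
    case False
    then show ?thesis
      by (simp add: dual_outside[OF Q_dual[OF p]] dual_outside[OF psd_dual[OF D_psd q]]
          dual_outside[OF G])
  qed
  ultimately have "saddle_op M R Q D (s + T q, q) = w"
    by (simp add: saddle_op_def wFG)
  with p q that[of "(s + T q, q)"] show ?thesis by simp
qed

end

text \<open>Two spectrally equivalent mass operators. The assumptions are symmetric in \<open>M1\<close> and \<open>M2\<close>, so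
  that every lemma may be used a second time with the two operators exchanged.\<close>

locale saddle_mass_pair =
  m1: saddle_mass X Y R Q D M1 + m2: saddle_mass X Y R Q D M2
  for X :: "('x \<Rightarrow> 'b::real_vector) set" and Y :: "('y \<Rightarrow> 'c::real_vector) set"
    and R Q D M1 M2 +
  fixes s :: real
  assumes s: "1 \<le> s"
    and le1: "\<sigma> \<in> X \<Longrightarrow> M1 \<sigma> \<sigma> \<le> s\<^sup>2 * M2 \<sigma> \<sigma>"
    and le2: "\<sigma> \<in> X \<Longrightarrow> M2 \<sigma> \<sigma> \<le> s\<^sup>2 * M1 \<sigma> \<sigma>"
begin

lemma norm_le1: "\<sigma> \<in> X \<Longrightarrow> sqrt (M1 \<sigma> \<sigma>) \<le> s * sqrt (M2 \<sigma> \<sigma>)"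
  using real_sqrt_le_mono[OF le1, of \<sigma>] s by (simp add: real_sqrt_mult)

lemma norm_le2: "\<sigma> \<in> X \<Longrightarrow> sqrt (M2 \<sigma> \<sigma>) \<le> s * sqrt (M1 \<sigma> \<sigma>)"
  using real_sqrt_le_mono[OF le2, of \<sigma>] s by (simp add: real_sqrt_mult)

text \<open>The \<open>M\<close>-norm of \<open>T u\<close> is the dual norm of the functional \<open>R u\<close>, and a dual norm changes by
  at most the factor by which the norm changes.\<close>

lemma T_le:
  assumes u: "u \<in> Y"
  shows "sqrt (M1 (m1.T u) (m1.T u)) \<le> s * sqrt (M2 (m2.T u) (m2.T u))"
proof (rule le_of_sq_le_mult)
  note t1 = m1.T_in[OF u] and t2 = m2.T_in[OF u]
  let ?n1 = "sqrt (M1 (m1.T u) (m1.T u))" and ?n2 = "sqrt (M2 (m2.T u) (m2.T u))"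
  have "?n1 * ?n1 = M1 (m1.T u) (m1.T u)"
    using psd_nonneg[OF m1.M_psd t1] by simp
  also have "\<dots> = M2 (m2.T u) (m1.T u)"
    by (simp add: m1.M_T m2.M_T u)
  also have "\<dots> \<le> ?n2 * sqrt (M2 (m1.T u) (m1.T u))"
    using psd_Cauchy_Schwarz[OF m2.M_psd m1.X_sub t2 t1] by simp
  also have "\<dots> \<le> ?n2 * (s * ?n1)"
    using norm_le2[OF t1] psd_nonneg[OF m2.M_psd t2] by (intro mult_left_mono) auto
  finally show "?n1 * ?n1 \<le> ?n1 * (s * ?n2)" by (simp add: algebra_simps)
  show "0 \<le> s * ?n2" using s psd_nonneg[OF m2.M_psd t2] by simp
qed

lemma N_le:
  assumes z: "z \<in> X \<times> Y"
  shows "m1.N z \<le> s * m2.N z"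
proof -
  obtain p q where zpq: "z = (p, q)" and p: "p \<in> X" and q: "q \<in> Y" using z by auto
  have "M1 (m1.T q) (m1.T q) = (sqrt (M1 (m1.T q) (m1.T q)))\<^sup>2"
    using psd_nonneg[OF m1.M_psd m1.T_in[OF q]] by simp
  also have "\<dots> \<le> (s * sqrt (M2 (m2.T q) (m2.T q)))\<^sup>2"
    using T_le[OF q] psd_nonneg[OF m1.M_psd m1.T_in[OF q]] by (intro power_mono) auto
  also have "\<dots> = s\<^sup>2 * M2 (m2.T q) (m2.T q)"
    using psd_nonneg[OF m2.M_psd m2.T_in[OF q]] by (simp add: power_mult_distrib)
  finally have "m1.A q q \<le> s\<^sup>2 * M2 (m2.T q) (m2.T q) + D q q"
    by (simp add: m1.A_diag q)
  also have "D q q \<le> s\<^sup>2 * D q q"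
    using s psd_nonneg[OF m1.D_psd q] by (simp add: mult_le_cancel_right1)
  finally have "m1.A q q \<le> s\<^sup>2 * m2.A q q"
    by (simp add: m2.A_diag q algebra_simps)
  from real_sqrt_le_mono[OF this] have "sqrt (m1.A q q) \<le> s * sqrt (m2.A q q)"
    using s by (simp add: real_sqrt_mult)
  with norm_le1[OF p] show ?thesis
    by (simp add: zpq prod_norm_def algebra_simps)
qed

text \<open>Subtract the codifferentials. With \<open>e = p - T\<^sub>1 q\<close> and \<open>f = \<sigma> - T\<^sub>2 u\<close> the first equation says
  that \<open>e\<close> and \<open>f\<close> represent the same functional, which bounds \<open>e\<close> by the data. Testing the second
  equation with \<open>q\<close> turns its left hand side into the energy of \<open>q\<close> plus a term in \<open>e\<close>, so the
  energy is bounded, and \<open>p = e + T\<^sub>1 q\<close> follows.\<close>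

lemma stability:
  assumes w: "w \<in> X \<times> Y" and z: "z \<in> X \<times> Y"
    and eq: "saddle_op M1 R Q D w = saddle_op M2 R Q D z"
  shows "m1.N w \<le> (5 * s + 2) * m2.N z"
proof -
  obtain p q where wpq: "w = (p, q)" and p: "p \<in> X" and q: "q \<in> Y" using w by auto
  obtain \<sigma> u where zsu: "z = (\<sigma>, u)" and \<sigma>: "\<sigma> \<in> X" and u: "u \<in> Y" using z by auto
  note t1 = m1.T_in[OF q] and t2 = m2.T_in[OF u] and t2q = m2.T_in[OF q]
  define e where "e = p - m1.T q"
  define f where "f = \<sigma> - m2.T u"
  have e: "e \<in> X" unfolding e_def by (intro fn.subspace_diff[OF m1.X_sub] p t1)
  have f: "f \<in> X" unfolding f_def by (intro fn.subspace_diff[OF m1.X_sub] \<sigma> t2)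
  let ?n = "\<lambda>M t. sqrt (M t t)"
  have n1: "0 \<le> ?n M1 t" "?n M1 t * ?n M1 t = M1 t t" if "t \<in> X" for t
    using psd_nonneg[OF m1.M_psd that] by auto
  have n2: "0 \<le> ?n M2 t" "?n M2 t * ?n M2 t = M2 t t" if "t \<in> X" for t
    using psd_nonneg[OF m2.M_psd that] by auto
  have cs1: "\<bar>M1 a b\<bar> \<le> ?n M1 a * ?n M1 b" if "a \<in> X" "b \<in> X" for a b
    using psd_Cauchy_Schwarz[OF m1.M_psd m1.X_sub that] .
  have cs2: "\<bar>M2 a b\<bar> \<le> ?n M2 a * ?n M2 b" if "a \<in> X" "b \<in> X" for a b
    using psd_Cauchy_Schwarz[OF m2.M_psd m1.X_sub that] .
  have A2: "0 \<le> m2.A u u" using psd_nonneg[OF m2.A_psd u] .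
  have A1: "0 \<le> m1.A q q" using psd_nonneg[OF m1.A_psd q] .
  have T2A: "?n M2 (m2.T u) \<le> ?n m2.A u"
    using psd_nonneg[OF m1.D_psd u] by (simp add: m2.A_diag u)
  have T1A: "?n M1 (m1.T q) \<le> ?n m1.A q"
    using psd_nonneg[OF m1.D_psd q] by (simp add: m1.A_diag q)
  have DA: "?n D u \<le> ?n m2.A u"
    using psd_nonneg[OF m2.M_psd t2] by (simp add: m2.A_diag u)
  have DA1: "?n D q \<le> ?n m1.A q"
    using psd_nonneg[OF m1.M_psd t1] by (simp add: m1.A_diag q)
  have Nz: "m2.N z = ?n M2 \<sigma> + ?n m2.A u" by (simp add: zsu prod_norm_def)
  have Nz0: "0 \<le> m2.N z" using n2(1)[OF \<sigma>] A2 by (simp add: Nz)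

  have eq1: "- M1 p t + R q t = - M2 \<sigma> t + R u t"
    and eq2: "Q p v + D q v = Q \<sigma> v + D u v" for t v
    using eq by (auto simp: saddle_op_def wpq zsu fun_eq_iff)

  have Me: "M1 e = M2 f"
    using eq1 by (simp add: e_def f_def psd_diff_left[OF m1.M_psd m1.X_sub]
        psd_diff_left[OF m2.M_psd m1.X_sub] p t1 \<sigma> t2 m1.M_T m2.M_T q u fun_eq_iff)
      (smt (verit))

  \<comment> \<open>The data in the first equation, measured in the norm of \<open>M2\<close>.\<close>
  have f_le: "?n M2 f \<le> m2.N z"
  proof (rule le_of_sq_le_mult)
    have "?n M2 f * ?n M2 f = M2 f \<sigma> - M2 f (m2.T u)"
      using dual_diff[OF psd_dual[OF m2.M_psd f] m1.X_sub \<sigma> t2] n2(2)[OF f]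
      by (simp add: f_def)
    also have "\<dots> \<le> ?n M2 f * ?n M2 \<sigma> + ?n M2 f * ?n M2 (m2.T u)"
      using cs2[OF f \<sigma>] cs2[OF f t2] by linarith
    also have "\<dots> \<le> ?n M2 f * ?n M2 \<sigma> + ?n M2 f * ?n m2.A u"
      using T2A n2(1)[OF f] by (intro add_left_mono mult_left_mono)
    finally show "?n M2 f * ?n M2 f \<le> ?n M2 f * m2.N z" by (simp add: Nz algebra_simps)
  qed (rule Nz0)

  have e_le: "?n M1 e \<le> s * m2.N z"
  proof (rule le_of_sq_le_mult)
    have "?n M1 e * ?n M1 e = M2 f e" using n1(2)[OF e] by (simp add: Me)
    also have "\<dots> \<le> ?n M2 f * ?n M2 e" using cs2[OF f e] by simp
    also have "\<dots> \<le> m2.N z * (s * ?n M1 e)"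
      using f_le norm_le2[OF e] n2(1)[OF f] n2(1)[OF e] Nz0 by (intro mult_mono)
    finally show "?n M1 e * ?n M1 e \<le> ?n M1 e * (s * m2.N z)" by (simp add: algebra_simps)
    show "0 \<le> s * m2.N z" using s Nz0 by simp
  qed

  \<comment> \<open>Each term on the right of the energy identity is linear in the energy norm of \<open>q\<close>.\<close>
  have q_le: "?n m1.A q \<le> (2 * s + 1) * m2.N z"
  proof (rule le_of_sq_le_mult)
    have "R q p = R q (m1.T q) + R q e"
      using dual_diff[OF m1.R_dual[OF q] m1.X_sub p t1] by (simp add: e_def)
    then have "m1.A q q = R q \<sigma> + D u q - M1 (m1.T q) e"
      using eq2[of q] by (simp add: m1.A_diag q m1.Q_transpose p \<sigma> m1.M_T)
    moreover have "R q \<sigma> \<le> ?n m1.A q * (s * ?n M2 \<sigma>)"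
    proof -
      have "R q \<sigma> \<le> ?n M1 (m1.T q) * ?n M1 \<sigma>"
        using cs1[OF t1 \<sigma>] by (simp add: m1.M_T q)
      also have "\<dots> \<le> ?n m1.A q * (s * ?n M2 \<sigma>)"
        using T1A norm_le1[OF \<sigma>] n1(1)[OF t1] n1(1)[OF \<sigma>] A1 by (intro mult_mono) auto
      finally show ?thesis .
    qed
    moreover have "D u q \<le> ?n m1.A q * ?n m2.A u"
    proof -
      have "D u q \<le> ?n D u * ?n D q"
        using psd_Cauchy_Schwarz[OF m1.D_psd m1.Y_sub u q] by simp
      also have "\<dots> \<le> ?n m2.A u * ?n m1.A q"
        using DA DA1 psd_nonneg[OF m1.D_psd u] psd_nonneg[OF m1.D_psd q] A2
        by (intro mult_mono) auto
      finally show ?thesis by (simp add: mult.commute)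
    qed
    moreover have "- M1 (m1.T q) e \<le> ?n m1.A q * (s * m2.N z)"
    proof -
      have "- M1 (m1.T q) e \<le> ?n M1 (m1.T q) * ?n M1 e"
        using cs1[OF t1 e] by simp
      also have "\<dots> \<le> ?n m1.A q * (s * m2.N z)"
        using T1A e_le n1(1)[OF t1] n1(1)[OF e] A1 by (intro mult_mono) auto
      finally show ?thesis .
    qed
    ultimately have "?n m1.A q * ?n m1.A q
        \<le> ?n m1.A q * (s * ?n M2 \<sigma> + ?n m2.A u + s * m2.N z)"
      using A1 by (simp add: algebra_simps)
    also have "\<dots> \<le> ?n m1.A q * ((2 * s + 1) * m2.N z)"
    proof (intro mult_left_mono)
      have "0 \<le> s * ?n m2.A u + ?n M2 \<sigma>" using s A2 n2(1)[OF \<sigma>] by simp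
      then show "s * ?n M2 \<sigma> + ?n m2.A u + s * m2.N z \<le> (2 * s + 1) * m2.N z"
        by (simp add: Nz algebra_simps)
    qed (use A1 in simp)
    finally show "?n m1.A q * ?n m1.A q \<le> ?n m1.A q * ((2 * s + 1) * m2.N z)" .
    show "0 \<le> (2 * s + 1) * m2.N z" using s Nz0 by simp
  qed

  have p_le: "?n M1 p \<le> ?n M1 e + ?n M1 (m1.T q)"
  proof (rule le_of_sq_le_mult)
    have "p = e + m1.T q" by (simp add: e_def)
    then have "M1 p p = M1 p e + M1 p (m1.T q)"
      using dual_add[OF psd_dual[OF m1.M_psd p] e t1] by simp
    then have "?n M1 p * ?n M1 p = M1 p e + M1 p (m1.T q)"
      using n1(2)[OF p] by simp
    also have "\<dots> \<le> ?n M1 p * ?n M1 e + ?n M1 p * ?n M1 (m1.T q)"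
      using cs1[OF p e] cs1[OF p t1] by linarith
    finally show "?n M1 p * ?n M1 p \<le> ?n M1 p * (?n M1 e + ?n M1 (m1.T q))"
      by (simp add: algebra_simps)
    show "0 \<le> ?n M1 e + ?n M1 (m1.T q)" using n1(1)[OF e] n1(1)[OF t1] by simp
  qed
  have "m1.N w = ?n M1 p + ?n m1.A q" by (simp add: wpq prod_norm_def)
  also have "\<dots> \<le> s * m2.N z + 2 * ((2 * s + 1) * m2.N z)"
    using p_le e_le T1A q_le by linarith
  also have "\<dots> = (5 * s + 2) * m2.N z" by (simp add: algebra_simps)
  finally show ?thesis .
qed

text \<open>The preconditioned operator maps \<open>z\<close> to the solution \<open>w\<close> of the system with the mass operator
  \<open>M1\<close> whose right hand side is that of \<open>z\<close> for \<open>M2\<close>, the situation of the stability estimate.\<close>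

lemma precond_saddle_solves:
  assumes z: "z \<in> X \<times> Y"
  shows "precond_op X Y M1 R Q D (saddle_op M2 R Q D z) \<in> X \<times> Y"
    and "saddle_op M1 R Q D (precond_op X Y M1 R Q D (saddle_op M2 R Q D z)) = saddle_op M2 R Q D z"
proof -
  obtain w where "w \<in> X \<times> Y" "saddle_op M1 R Q D w = saddle_op M2 R Q D z"
    using m1.saddle_surj[OF m2.saddle_in_dual[OF z]] .
  with m1.precond_saddle[of w]
  show "precond_op X Y M1 R Q D (saddle_op M2 R Q D z) \<in> X \<times> Y"
    and "saddle_op M1 R Q D (precond_op X Y M1 R Q D (saddle_op M2 R Q D z)) = saddle_op M2 R Q D z"
    by simp_all
qed

end

lemma op_norm_le:
  assumes "\<And>z. z \<in> Z \<Longrightarrow> N (F z) \<le> c * N z" and "0 \<le> c"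
  shows "op_norm Z N F \<le> ereal c"
  unfolding op_norm_def
proof (rule SUP_least)
  fix z assume z: "z \<in> {z \<in> Z. N z \<le> 1}"
  have "N (F z) \<le> c * N z" using z assms(1) by simp
  also have "\<dots> \<le> c * 1" using z assms(2) by (intro mult_left_mono) auto
  finally show "ereal (N (F z)) \<le> ereal c" by simp
qed

context saddle_mass_pair
begin

text \<open>Both bounds are the stability estimate, once for the pair \<open>(M1, M2)\<close> and once for
  \<open>(M2, M1)\<close>, combined with the comparison of the two norms.\<close>

lemma preconditioned_bounds:
  defines "F \<equiv> precond_op X Y M1 R Q D \<circ> saddle_op M2 R Q D"
  shows "bij_betw F (X \<times> Y) (X \<times> Y)"
    and "op_norm (X \<times> Y) m2.N F \<le> ereal (s * (5 * s + 2))"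
    and "op_norm (X \<times> Y) m2.N (inv_into (X \<times> Y) F) \<le> ereal (s * (5 * s + 2))"
proof -
  interpret swap: saddle_mass_pair X Y R Q D M2 M1 s
    by unfold_locales (rule s, erule le2, erule le1)
  have F: "F z \<in> X \<times> Y" "saddle_op M1 R Q D (F z) = saddle_op M2 R Q D z" if "z \<in> X \<times> Y" for z
    using precond_saddle_solves[OF that] by (simp_all add: F_def)
  have inj: "inj_on F (X \<times> Y)"
  proof (rule inj_onI)
    fix z z' assume z: "z \<in> X \<times> Y" and z': "z' \<in> X \<times> Y" and "F z = F z'"
    then have "saddle_op M2 R Q D z = saddle_op M2 R Q D z'"
      using F(2)[OF z] F(2)[OF z'] by simp
    from arg_cong[OF this, of "precond_op X Y M2 R Q D"] show "z = z'"
      by (simp only: m2.precond_saddle[OF z] m2.precond_saddle[OF z'])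
  qed
  have surj: "w \<in> F ` (X \<times> Y)" if w: "w \<in> X \<times> Y" for w
  proof (rule image_eqI)
    \<comment> \<open>The inverse of the preconditioned operator is itself a preconditioned operator.\<close>
    let ?z = "precond_op X Y M2 R Q D (saddle_op M1 R Q D w)"
    show "?z \<in> X \<times> Y" by (rule swap.precond_saddle_solves(1)[OF w])
    show "w = F ?z"
      by (simp add: F_def swap.precond_saddle_solves(2)[OF w] m1.precond_saddle[OF w])
  qed
  show bij: "bij_betw F (X \<times> Y) (X \<times> Y)"
    unfolding bij_betw_def using inj surj F(1) by blast
  have c: "0 \<le> s * (5 * s + 2)" using s by simp
  show "op_norm (X \<times> Y) m2.N F \<le> ereal (s * (5 * s + 2))"
  proof (rule op_norm_le[OF _ c])
    fix z assume z: "z \<in> X \<times> Y"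
    have "m2.N (F z) \<le> s * m1.N (F z)" by (rule swap.N_le[OF F(1)[OF z]])
    also have "\<dots> \<le> s * ((5 * s + 2) * m2.N z)"
      using stability[OF F(1)[OF z] z F(2)[OF z]] s by (intro mult_left_mono) auto
    finally show "m2.N (F z) \<le> s * (5 * s + 2) * m2.N z" by (simp add: mult.assoc)
  qed
  show "op_norm (X \<times> Y) m2.N (inv_into (X \<times> Y) F) \<le> ereal (s * (5 * s + 2))"
  proof (rule op_norm_le[OF _ c])
    fix w assume w: "w \<in> X \<times> Y"
    define z where "z = inv_into (X \<times> Y) F w"
    have z: "z \<in> X \<times> Y" unfolding z_def by (rule inv_into_into[OF surj[OF w]])
    have Fz: "F z = w" unfolding z_def by (rule f_inv_into_f[OF surj[OF w]])
    have "m2.N z \<le> (5 * s + 2) * m1.N w"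
      using swap.stability[OF z w] F(2)[OF z] Fz by simp
    also have "\<dots> \<le> (5 * s + 2) * (s * m2.N w)"
      using N_le[OF w] s by (intro mult_left_mono) auto
    finally show "m2.N (inv_into (X \<times> Y) F w) \<le> s * (5 * s + 2) * m2.N w"
      by (simp add: z_def[symmetric] algebra_simps)
  qed
qed

end

text \<open>The constant depends on the mesh only through the equivalence constants \<open>c\<^sub>1\<close> and \<open>c\<^sub>2\<close>. The
  upper bound of the spectral equivalence also transfers definiteness from \<open>Mt\<close> to \<open>M\<close>.\<close>

lemma uniform_preconditioner_saddle:
  assumes sys: "\<And>h. h \<in> H \<Longrightarrow> saddle_system (X h) (Y h) (R h) (Q h) (D h)"
    and M: "\<And>h. h \<in> H \<Longrightarrow> psd_op (X h) (M h)"
    and Mt: "\<And>h. h \<in> H \<Longrightarrow> spd_op (X h) (Mt h)"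
    and equiv: "uniformly_spectrally_equivalent H X Mt M"
  shows "uniform_preconditioner H (\<lambda>h. X h \<times> Y h)
    (\<lambda>h. prod_norm (M h) (schur_op (X h) (M h) (R h) (Q h) (D h)))
    (\<lambda>h. precond_op (X h) (Y h) (Mt h) (R h) (Q h) (D h))
    (\<lambda>h. saddle_op (M h) (R h) (Q h) (D h))"
proof -
  obtain c1 c2 where c: "0 < c1" "0 < c2"
    and lower: "\<And>h \<sigma>. h \<in> H \<Longrightarrow> \<sigma> \<in> X h \<Longrightarrow> c1 * M h \<sigma> \<sigma> \<le> Mt h \<sigma> \<sigma>"
    and upper: "\<And>h \<sigma>. h \<in> H \<Longrightarrow> \<sigma> \<in> X h \<Longrightarrow> Mt h \<sigma> \<sigma> \<le> c2 * M h \<sigma> \<sigma>"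
    using equiv unfolding uniformly_spectrally_equivalent_def by blast
  \<comment> \<open>The maximum with 1 lets the factor \<open>s\<^sup>2\<close> absorb the \<open>D\<close>-part of the energy as well.\<close>
  define s where "s = sqrt (max 1 (max c2 (1 / c1)))"
  have s1: "1 \<le> s" by (simp add: s_def)
  have s2: "c2 \<le> s\<^sup>2" "1 / c1 \<le> s\<^sup>2" by (simp_all add: s_def)
  have pair: "saddle_mass_pair (X h) (Y h) (R h) (Q h) (D h) (Mt h) (M h) s" if h: "h \<in> H" for h
  proof -
    interpret saddle_system "X h" "Y h" "R h" "Q h" "D h" using sys[OF h] .
    have "\<sigma> = 0" if \<sigma>: "\<sigma> \<in> X h" and "M h \<sigma> \<sigma> = 0" for \<sigma>
    proof -
      have "Mt h \<sigma> \<sigma> \<le> 0" using upper[OF h \<sigma>] that by simp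
      then show ?thesis using Mt[OF h] \<sigma> unfolding spd_op_def zero_fun_def by fastforce
    qed
    then have "spd_op (X h) (M h)" using M[OF h] by (simp add: spd_op_iff[OF X_sub])
    then interpret m2: saddle_mass "X h" "Y h" "R h" "Q h" "D h" "M h" by unfold_locales
    interpret m1: saddle_mass "X h" "Y h" "R h" "Q h" "D h" "Mt h"
      using Mt[OF h] by unfold_locales
    show ?thesis
    proof (unfold_locales)
      fix \<sigma> assume \<sigma>: "\<sigma> \<in> X h"
      note n = psd_nonneg[OF m2.M_psd \<sigma>] psd_nonneg[OF m1.M_psd \<sigma>]
      show "Mt h \<sigma> \<sigma> \<le> s\<^sup>2 * M h \<sigma> \<sigma>"
        by (rule order_trans[OF upper[OF h \<sigma>] mult_right_mono[OF s2(1) n(1)]])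
      have "M h \<sigma> \<sigma> \<le> 1 / c1 * Mt h \<sigma> \<sigma>"
        using lower[OF h \<sigma>] c by (simp add: field_simps)
      then show "M h \<sigma> \<sigma> \<le> s\<^sup>2 * Mt h \<sigma> \<sigma>"
        by (rule order_trans[OF _ mult_right_mono[OF s2(2) n(2)]])
    qed (rule s1)
  qed
  show ?thesis
    unfolding uniform_preconditioner_def
    by (intro exI[of _ "s * (5 * s + 2)"] ballI conjI)
      (erule saddle_mass_pair.preconditioned_bounds[OF pair])+
qed

section \<open>Smooth bumps on boxes\<close>

lemma partial_eqI: "(f has_derivative f') (at x) \<Longrightarrow> partial i f x = f' (axis i 1)"
  by (simp add: partial_def frechet_derivative_at[symmetric])

lemma has_derivative_frechet:
  "f differentiable (at x) \<Longrightarrow> (f has_derivative frechet_derivative f (at x)) (at x)"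
  by (simp add: frechet_derivative_works)

lemma partial_add:
  assumes "f differentiable (at x)" "g differentiable (at x)"
  shows "partial i (\<lambda>x. f x + g x) x = partial i f x + partial i g x"
  using partial_eqI[OF has_derivative_add[OF assms[THEN has_derivative_frechet]]]
  by (simp add: partial_def)

lemma partial_scale:
  assumes "f differentiable (at x)"
  shows "partial i (\<lambda>x. c * f x) x = c * partial i f x"
  using partial_eqI[OF has_derivative_mult_right[OF assms[THEN has_derivative_frechet]]]
  by (simp add: partial_def)

lemma partial_mult:
  assumes "f differentiable (at x)" "g differentiable (at x)"
  shows "partial i (\<lambda>x. f x * g x) x = f x * partial i g x + partial i f x * g x"
  using partial_eqI[OF has_derivative_mult[OF assms[THEN has_derivative_frechet]]]
  by (simp add: partial_def)

lemma Ck_Suc_imp: "Ck (Suc k) f \<Longrightarrow> Ck k f"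
proof (induction k arbitrary: f)
  case 0
  then show ?case
    by (auto intro!: continuous_at_imp_continuous_on differentiable_imp_continuous_within)
next
  case (Suc k)
  have "(\<forall>x. f differentiable at x) \<and> (\<forall>i. Ck (Suc k) (partial i f))"
    using Suc.prems by (rule Ck.simps(2)[THEN iffD1])
  then show ?case using Suc.IH by (intro Ck.simps(2)[THEN iffD2]) blast
qed

lemma Ck_add: "Ck k f \<Longrightarrow> Ck k g \<Longrightarrow> Ck k (\<lambda>x. f x + g x)"
proof (induction k arbitrary: f g)
  case (Suc k)
  then have "partial i (\<lambda>x. f x + g x) = (\<lambda>x. partial i f x + partial i g x)" for i
    by (intro ext partial_add) auto
  with Suc show ?case by auto
qed (auto intro: continuous_on_add)

lemma Ck_scale: "Ck k f \<Longrightarrow> Ck k (\<lambda>x. c * f x)"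
proof (induction k arbitrary: f)
  case (Suc k)
  then have "partial i (\<lambda>x. c * f x) = (\<lambda>x. c * partial i f x)" for i
    by (intro ext partial_scale) auto
  with Suc show ?case by auto
qed (auto intro: continuous_on_mult_left)

lemma Ck_mult: "Ck k f \<Longrightarrow> Ck k g \<Longrightarrow> Ck k (\<lambda>x. f x * g x)"
proof (induction k arbitrary: f g)
  case (Suc k)
  then have "partial i (\<lambda>x. f x * g x) = (\<lambda>x. f x * partial i g x + partial i f x * g x)" for i
    by (intro ext partial_mult) auto
  moreover have "Ck k f" "Ck k g" using Suc.prems by (auto dest!: Ck_Suc_imp simp del: Ck.simps)
  ultimately show ?case using Suc by (auto intro!: Ck_add)
qed (auto intro: continuous_on_mult)

lemma Ck_const: "Ck k (\<lambda>x. c)"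
proof (induction k arbitrary: c)
  case (Suc k)
  have "partial i (\<lambda>x. c) = (\<lambda>x. 0)" for i
    using partial_eqI[OF has_derivative_const[of c]] by auto
  with Suc show ?case by auto
qed auto

lemma Ck_prod: "finite I \<Longrightarrow> (\<And>i. i \<in> I \<Longrightarrow> Ck k (f i)) \<Longrightarrow> Ck k (\<lambda>x. \<Prod>i\<in>I. f i x)"
  by (induction I rule: finite_induct) (auto intro: Ck_const Ck_mult)

text \<open>The powers in the denominator are there because the derivative of each of these functions is
  a linear combination of two others. Smoothness of \<open>flat_exp 0\<close> thus follows by induction on the
  order of differentiation, for all \<open>k\<close> simultaneously.\<close>

definition flat_exp :: "nat \<Rightarrow> real \<Rightarrow> real" where
  "flat_exp k t = (if t > 0 then exp (- 1 / t) / t ^ k else 0)"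

lemma flat_exp_tendsto_0: "(flat_exp k \<longlongrightarrow> 0) (at 0)"
proof -
  have "((\<lambda>t::real. (1 / t) ^ k / exp (1 / t)) \<longlongrightarrow> 0) (at_right 0)"
    using filterlim_compose[OF tendsto_power_div_exp_0 filterlim_inverse_at_top_right, of k]
    by (simp add: inverse_eq_divide)
  then have "(flat_exp k \<longlongrightarrow> 0) (at_right 0)"
    by (rule Lim_transform_eventually)
      (auto simp: flat_exp_def eventually_at_filter exp_minus power_divide field_simps)
  moreover have "(flat_exp k \<longlongrightarrow> 0) (at_left 0)"
    by (rule Lim_transform_eventually[OF tendsto_const])
      (auto simp: flat_exp_def eventually_at_filter)
  ultimately show ?thesis by (simp add: filterlim_split_at)
qed

lemma flat_exp_deriv:
  "(flat_exp k has_real_derivative (flat_exp (k + 2) t - real k * flat_exp (k + 1) t)) (at t)"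
proof -
  consider "t < 0" | "t = 0" | "t > 0" by linarith
  then show ?thesis
  proof cases
    case 1
    have "((\<lambda>_. 0) has_real_derivative 0) (at t)" by simp
    then have "(flat_exp k has_real_derivative 0) (at t)"
      by (rule has_field_derivative_transform_within_open[where S = "{..<0}"])
        (use 1 in \<open>auto simp: flat_exp_def\<close>)
    with 1 show ?thesis by (simp add: flat_exp_def)
  next
    case 2
    have "((\<lambda>h. (flat_exp k (0 + h) - flat_exp k 0) / h) \<longlongrightarrow> 0) (at 0)"
      \<comment> \<open>The difference quotient of \<open>flat_exp k\<close> at 0 is \<open>flat_exp (k + 1)\<close>.\<close>
      by (rule Lim_transform_eventually[OF flat_exp_tendsto_0[of "k + 1"]])
        (auto simp: flat_exp_def eventually_at_filter)
    then have "(flat_exp k has_real_derivative 0) (at 0)" by (simp add: DERIV_def)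
    with 2 show ?thesis by (simp add: flat_exp_def)
  next
    case 3
    have "((\<lambda>t. exp (- 1 / t) / t ^ k) has_real_derivative
        (exp (- 1 / t) / t ^ (k + 2) - real k * (exp (- 1 / t) / t ^ (k + 1)))) (at t)"
    proof -
      have "n = 0" if "t ^ n \<noteq> t * t ^ (n - Suc 0)" for n using that by (cases n) auto
      with 3 show ?thesis
        by (cases k) (auto intro!: derivative_eq_intros simp: field_simps power2_eq_square)
    qed
    then have "(flat_exp k has_real_derivative
        (exp (- 1 / t) / t ^ (k + 2) - real k * (exp (- 1 / t) / t ^ (k + 1)))) (at t)"
      by (rule has_field_derivative_transform_within_open[where S = "{0<..}"])
        (use 3 in \<open>auto simp: flat_exp_def\<close>)
    with 3 show ?thesis by (simp add: flat_exp_def)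
  qed
qed

lemma flat_exp_affine_derivative:
  "((\<lambda>x::real^3. flat_exp k (\<alpha> * x $ i + \<beta>)) has_derivative
     (\<lambda>h. (flat_exp (k + 2) (\<alpha> * x $ i + \<beta>) - real k * flat_exp (k + 1) (\<alpha> * x $ i + \<beta>))
       * (\<alpha> * h $ i))) (at x)"
proof -
  have "((\<lambda>x::real^3. \<alpha> * x $ i + \<beta>) has_derivative (\<lambda>h. \<alpha> * h $ i)) (at x)"
    by (auto intro!: derivative_eq_intros bounded_linear_imp_has_derivative bounded_linear_vec_nth)
  from has_derivative_compose[OF this flat_exp_deriv[unfolded has_field_derivative_def]]
  show ?thesis by simp
qed

lemma Ck_flat_exp_affine: "Ck n (\<lambda>x. flat_exp k (\<alpha> * x $ i + \<beta>))"
proof (induction n arbitrary: k)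
  case 0
  show ?case
    using flat_exp_affine_derivative[THEN has_derivative_continuous]
    by (auto intro: continuous_at_imp_continuous_on)
next
  case (Suc n)
  have "partial j (\<lambda>x. flat_exp k (\<alpha> * x $ i + \<beta>)) =
      (\<lambda>x. (if j = i then \<alpha> else 0) * (flat_exp (k + 2) (\<alpha> * x $ i + \<beta>)
        + (- real k) * flat_exp (k + 1) (\<alpha> * x $ i + \<beta>)))" for j
  proof
    fix x :: "real^3"
    show "partial j (\<lambda>x. flat_exp k (\<alpha> * x $ i + \<beta>)) x =
      (if j = i then \<alpha> else 0) * (flat_exp (k + 2) (\<alpha> * x $ i + \<beta>)
        + (- real k) * flat_exp (k + 1) (\<alpha> * x $ i + \<beta>))"
      by (subst partial_eqI[OF flat_exp_affine_derivative]) (auto simp: axis_def)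
  qed
  moreover have "(\<lambda>x. flat_exp k (\<alpha> * x $ i + \<beta>)) differentiable (at x)" for x
    unfolding differentiable_def by (rule exI) (rule flat_exp_affine_derivative)
  moreover have "Ck n (\<lambda>x. (if j = i then \<alpha> else 0) * (flat_exp (k + 2) (\<alpha> * x $ i + \<beta>)
        + (- real k) * flat_exp (k + 1) (\<alpha> * x $ i + \<beta>)))" for j
    by (intro Ck_scale Ck_add Suc)
  ultimately show ?case by (simp only: Ck.simps) simp
qed

text \<open>The bump lives on \<open>box a b\<close>. Each factor with argument \<open>n t\<close> is the \<open>n\<close>-th root of the factor
  with argument \<open>t\<close>, so that the bumps increase to the indicator of the box as \<open>n\<close> grows.\<close>

definition box_bump :: "real^3 \<Rightarrow> real^3 \<Rightarrow> nat \<Rightarrow> real^3 \<Rightarrow> real" where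
  "box_bump a b n x = (\<Prod>i\<in>UNIV. flat_exp 0 (real n * (x $ i - a $ i)) *
                                  flat_exp 0 (real n * (b $ i - x $ i)))"

lemma Ck_box_bump: "Ck k (box_bump a b n)"
proof -
  have "Ck k (\<lambda>x. flat_exp 0 (real n * (x $ i - a $ i)))"
    and "Ck k (\<lambda>x. flat_exp 0 (real n * (b $ i - x $ i)))" for i
    using Ck_flat_exp_affine[of k 0 "real n" i "- (real n * a $ i)"]
      Ck_flat_exp_affine[of k 0 "- real n" i "real n * b $ i"]
    by (simp_all add: algebra_simps)
  then show ?thesis
    unfolding box_bump_def[abs_def] by (intro Ck_prod Ck_mult) auto
qed

lemma box_bump_outside: "x \<notin> box a b \<Longrightarrow> box_bump a b n x = 0"
proof -
  assume "x \<notin> box a b"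
  then obtain i where "\<not> (a $ i < x $ i \<and> x $ i < b $ i)" by (auto simp: mem_box_cart)
  then have "flat_exp 0 (real n * (x $ i - a $ i)) * flat_exp 0 (real n * (b $ i - x $ i)) = 0"
    by (auto simp: flat_exp_def zero_less_mult_iff)
  then show ?thesis unfolding box_bump_def by (intro prod_zero) auto
qed

lemma box_bump_bounds: "0 \<le> box_bump a b n x" "box_bump a b n x \<le> 1"
proof -
  have "0 \<le> flat_exp 0 t" "flat_exp 0 t \<le> 1" for t by (auto simp: flat_exp_def)
  then show "0 \<le> box_bump a b n x" "box_bump a b n x \<le> 1"
    unfolding box_bump_def by (auto intro!: prod_nonneg prod_le_1 mult_le_one)
qed

lemma box_bump_tendsto: "(\<lambda>n. box_bump a b n x) \<longlonglongrightarrow> indicator (box a b) x"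
proof (cases "x \<in> box a b")
  case False
  then show ?thesis by (simp add: box_bump_outside)
next
  case True
  have *: "(\<lambda>n. flat_exp 0 (real n * t)) \<longlonglongrightarrow> 1" if t: "0 < t" for t
  proof -
    have "(\<lambda>n. exp (- ((1 / t) / real n))) \<longlonglongrightarrow> exp (- 0)"
      by (intro tendsto_intros lim_const_over_n)
    then have "(\<lambda>n. exp (- ((1 / t) / real n))) \<longlonglongrightarrow> 1" by simp
    then show ?thesis
      by (rule Lim_transform_eventually)
        (use t in \<open>auto simp: flat_exp_def eventually_sequentially field_simps intro!: exI[of _ 1]\<close>)
  qed
  have "(\<lambda>n. box_bump a b n x) \<longlonglongrightarrow> (\<Prod>i\<in>(UNIV::3 set). 1 * 1)"
    unfolding box_bump_def using True
    by (intro tendsto_prod tendsto_mult *) (auto simp: mem_box_cart)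
  with True show ?thesis by simp
qed

lemma box_bump_test_function:
  assumes "cbox a b \<subseteq> \<Omega>"
  shows "box_bump a b n \<in> test_functions \<Omega>"
  unfolding test_functions_def using assms Ck_box_bump box_bump_outside box_subset_cbox
  by (fastforce intro!: exI[of _ "cbox a b"])

section \<open>Integrals over boxes determine a function\<close>

text \<open>Boxes generate the Borel sets and are stable under intersection, so Dynkin's \<open>\<pi>\<close>-\<open>\<lambda>\<close> argument
  extends the vanishing of the integral from boxes to all Borel sets. The total integral is
  assumed to vanish because the whole space is not a box.\<close>

lemma AE_zero_of_box_integrals_lborel:
  fixes f :: "'a::euclidean_space \<Rightarrow> real"
  assumes f: "integrable lborel f"
    and total: "integral\<^sup>L lborel f = 0"
    and box: "\<And>a b. (LINT x:box a b|lborel. f x) = 0"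
  shows "AE x in lborel. f x = 0"
proof (rule density_unique_real[OF f, of "\<lambda>_. 0"])
  have si: "set_integrable lborel A f" if "A \<in> sets borel" for A
    using f that unfolding set_integrable_def by (intro integrable_mult_indicator) auto
  fix A :: "'a set"
  assume "A \<in> sets lborel"
  then have A: "A \<in> sigma_sets UNIV (range (\<lambda>(a, b). box a b))"
    by (simp add: borel_eq_box)
  have stable: "Int_stable (range (\<lambda>(a, b). box a b :: 'a set))"
    by (auto simp: Int_stable_def box_Int_box)
  have "range (\<lambda>(a, b). box a b :: 'a set) \<subseteq> Pow UNIV" by simp
  from stable this A have "(LINT x:A|lborel. f x) = 0"
  proof (induction A rule: sigma_sets_induct_disjoint)
    case (basic A)
    then show ?case using box by auto
  next
    case empty
    show ?case by (simp add: set_lebesgue_integral_def)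
  next
    case (compl A)
    have A: "A \<in> sets borel" using compl(1) by (simp add: borel_eq_box)
    have "(LINT x:(UNIV - A) \<union> A|lborel. f x) = (LINT x:UNIV - A|lborel. f x) + (LINT x:A|lborel. f x)"
      by (rule set_integral_Un) (use A in \<open>auto intro: si\<close>)
    then show ?case using total compl by (simp add: set_lebesgue_integral_def)
  next
    case (union A)
    have A: "A i \<in> sets borel" for i using union(2) by (auto simp: borel_eq_box)
    have "(LINT x:(\<Union>i. A i)|lborel. f x) = (\<Sum>i. LINT x:A i|lborel. f x)"
    proof (rule lebesgue_integral_countable_add)
      show "A i \<in> sets lborel" for i using A by simp
      show "A i \<inter> A j = {}" if "i \<noteq> j" for i j
        using union(1) that by (simp add: disjoint_family_on_def)
      show "set_integrable lborel (\<Union>i. A i) f" using A by (intro si) auto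
    qed
    then show ?case using union(3) by simp
  qed
  then show "(LINT x:A|lborel. f x) = (LINT x:A|lborel. 0)" by simp
qed simp

text \<open>A Lebesgue measurable function agrees with a Borel function outside a null set.\<close>

lemma AE_zero_of_box_integrals:
  fixes f :: "'a::euclidean_space \<Rightarrow> real"
  assumes f: "integrable lebesgue f"
    and total: "integral\<^sup>L lebesgue f = 0"
    and box: "\<And>a b. (LINT x:box a b|lebesgue. f x) = 0"
  shows "AE x in lebesgue. f x = 0"
proof -
  obtain g where g: "g \<in> borel_measurable lborel" and ae: "AE x in lborel. f x = g x"
    using completion_ex_borel_measurable_real[OF borel_measurable_integrable[OF f]] by auto
  have ae': "AE x in lebesgue. f x = g x" using AE_completion[OF ae] .
  have gl: "integrable lebesgue g"
    using integrable_cong_AE_imp[OF f measurable_completion[OF g]] ae' by (simp add: eq_commute)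
  have "AE x in lborel. g x = 0"
  proof (rule AE_zero_of_box_integrals_lborel)
    show "integrable lborel g" using gl g by (simp add: integrable_completion)
    have "integral\<^sup>L lebesgue g = integral\<^sup>L lebesgue f"
      using ae' measurable_completion[OF g] borel_measurable_integrable[OF f]
      by (intro integral_cong_AE) (simp_all add: eq_commute)
    then show "integral\<^sup>L lborel g = 0" using total g by (simp add: integral_completion)
    fix a b :: 'a
    have m: "(\<lambda>x. indicator (box a b) x *\<^sub>R g x) \<in> borel_measurable lborel" using g by measurable
    have "(LINT x:box a b|lborel. g x) = (LINT x:box a b|lebesgue. g x)"
      unfolding set_lebesgue_integral_def using integral_completion[OF m] by simp
    also have "\<dots> = (LINT x:box a b|lebesgue. f x)"
      unfolding set_lebesgue_integral_def
    proof (rule integral_cong_AE)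
      show "(\<lambda>x. indicator (box a b) x *\<^sub>R g x) \<in> borel_measurable lebesgue"
        using m by (rule measurable_completion)
      show "(\<lambda>x. indicator (box a b) x *\<^sub>R f x) \<in> borel_measurable lebesgue"
        using borel_measurable_integrable[OF f]
        by (intro borel_measurable_scaleR borel_measurable_indicator) auto
      show "AE x in lebesgue. indicator (box a b) x *\<^sub>R g x = indicator (box a b) x *\<^sub>R f x"
        using ae' by eventually_elim simp
    qed
    finally show "(LINT x:box a b|lborel. g x) = 0" using box by simp
  qed
  from AE_completion[OF this] ae' show ?thesis by eventually_elim simp
qed

text \<open>The whole space is replaced by one box with closure in \<open>\<Omega>\<close>: restricted to it, the function
  satisfies the hypotheses of the previous lemma since boxes intersect in boxes. By Lindelof's
  theorem countably many such boxes cover \<open>\<Omega>\<close>, so the exceptional null sets add up to a null set.\<close>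

lemma AE_zero_of_inner_box_integrals:
  fixes g :: "'a::euclidean_space \<Rightarrow> real"
  assumes \<Omega>: "open \<Omega>" and g: "integrable (lebesgue_on \<Omega>) g"
    and box: "\<And>a b. cbox a b \<subseteq> \<Omega> \<Longrightarrow> integral\<^sup>L (lebesgue_on \<Omega>) (\<lambda>x. indicator (box a b) x * g x) = 0"
  shows "AE x in lebesgue_on \<Omega>. g x = 0"
proof -
  have om: "\<Omega> \<inter> space lebesgue \<in> sets lebesgue" using \<Omega> by simp
  define F where "F = {box a b | a b. cbox a b \<subseteq> \<Omega>}"
  have "\<And>S. S \<in> F \<Longrightarrow> open S" by (auto simp: F_def open_box)
  then obtain F' where F': "F' \<subseteq> F" "countable F'" "\<Union>F' = \<Union>F"
    using Lindelof[of F] by blast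
  have cover: "\<Omega> \<subseteq> \<Union>F"
  proof
    fix x assume "x \<in> \<Omega>"
    then obtain a b where "cbox a b \<subseteq> \<Omega>" "x \<in> box a b"
      using open_contains_cbox[OF \<Omega>] by metis
    then show "x \<in> \<Union>F" by (auto simp: F_def)
  qed
  have on_box: "AE x in lebesgue. x \<in> B \<longrightarrow> g x = 0" if BF: "B \<in> F'" for B
  proof -
    obtain c d where B: "B = box c d" and cd: "cbox c d \<subseteq> \<Omega>" using BF F'(1) unfolding F_def by blast
    define h where "h x = indicator (box c d) x * g x" for x
    have ind: "indicator \<Omega> x *\<^sub>R (indicator A x * g x) = indicator A x * g x"
      if "A \<subseteq> box c d" for A x
      using that cd box_subset_cbox[of c d] by (auto simp: indicator_def)
    have hh: "indicator (box a b) x *\<^sub>R h x = indicator (box a b \<inter> box c d) x * g x" for a b x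
      by (auto simp: h_def indicator_def)
    have "integrable lebesgue (\<lambda>x. indicator (box c d) x *\<^sub>R (indicator \<Omega> x *\<^sub>R g x))"
      by (rule integrable_mult_indicator[OF _ g[unfolded integrable_restrict_space[OF om]]]) simp
    moreover have "indicator (box c d) x *\<^sub>R (indicator \<Omega> x *\<^sub>R g x) = h x" for x
      using ind[of "box c d" x] by (simp add: h_def mult_ac)
    ultimately have hi: "integrable lebesgue h" by simp
    have sub: "integral\<^sup>L lebesgue (\<lambda>x. indicator (box a b \<inter> box c d) x * g x) = 0" for a b
    proof -
      obtain p q where pq: "box a b \<inter> box c d = box p q" using box_Int_box[of a b c d] by blast
      \<comment> \<open>An empty box does not determine \<open>p\<close> and \<open>q\<close>, so \<open>cbox p q\<close> need not lie in \<open>\<Omega>\<close>.\<close>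
      show ?thesis
      proof (cases "box p q = {}")
        case False
        have "box p q \<subseteq> box c d" using pq by auto
        moreover from this have "box c d \<noteq> {}" using False by blast
        ultimately have "cbox p q \<subseteq> cbox c d"
          using closure_mono[of "box p q" "box c d"] False by (simp add: closure_box)
        with cd have "cbox p q \<subseteq> \<Omega>" by (rule subset_trans[rotated])
        from box[OF this] show ?thesis
          using \<open>box p q \<subseteq> box c d\<close>
          unfolding integral_restrict_space[OF om] pq by (simp only: ind)
      qed (simp add: pq)
    qed
    have "AE x in lebesgue. h x = 0"
    proof (rule AE_zero_of_box_integrals[OF hi])
      show "integral\<^sup>L lebesgue h = 0" using sub[of c d] by (simp add: h_def[abs_def])
      show "(LINT x:box a b|lebesgue. h x) = 0" for a b
        unfolding set_lebesgue_integral_def hh by (rule sub)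
    qed
    then show ?thesis by eventually_elim (auto simp: h_def B)
  qed
  have "AE x in lebesgue. \<forall>B\<in>F'. x \<in> B \<longrightarrow> g x = 0"
    using on_box F'(2) by (subst AE_ball_countable) auto
  then have "AE x in lebesgue. x \<in> \<Omega> \<longrightarrow> g x = 0"
    using cover F'(3) by (elim AE_mp, intro AE_I2) auto
  then show ?thesis using AE_restrict_space_iff[OF om] by blast
qed

section \<open>Square integrable functions\<close>

lemma L2_measurable: "u \<in> L2 \<Omega> \<Longrightarrow> u \<in> borel_measurable (lebesgue_on \<Omega>)"
  and L2_square: "u \<in> L2 \<Omega> \<Longrightarrow> integrable (lebesgue_on \<Omega>) (\<lambda>x. (norm (u x))\<^sup>2)"
  by (auto simp: L2_def)

lemma norm_add_square_le:
  fixes u v :: "'a::real_normed_vector"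
  shows "(norm (u + v))\<^sup>2 \<le> 2 * (norm u)\<^sup>2 + 2 * (norm v)\<^sup>2"
proof -
  have "(norm (u + v))\<^sup>2 \<le> (norm u + norm v)\<^sup>2"
    by (intro power_mono norm_triangle_ineq) simp
  also have "\<dots> \<le> 2 * (norm u)\<^sup>2 + 2 * (norm v)\<^sup>2"
    using sum_squares_bound[of "norm u" "norm v"] by (simp add: power2_sum)
  finally show ?thesis .
qed

lemma L2_add:
  assumes u: "u \<in> L2 \<Omega>" and v: "v \<in> L2 \<Omega>"
  shows "(\<lambda>x. u x + v x) \<in> L2 \<Omega>"
proof -
  note [measurable] = L2_measurable[OF u] L2_measurable[OF v]
  have "integrable (lebesgue_on \<Omega>) (\<lambda>x. 2 * (norm (u x))\<^sup>2 + 2 * (norm (v x))\<^sup>2)"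
    using L2_square[OF u] L2_square[OF v] by simp
  then have "integrable (lebesgue_on \<Omega>) (\<lambda>x. (norm (u x + v x))\<^sup>2)"
    by (rule Bochner_Integration.integrable_bound)
      (use norm_add_square_le in \<open>auto intro!: AE_I2\<close>)
  then show ?thesis by (simp add: L2_def)
qed

lemma L2_scale:
  assumes u: "u \<in> L2 \<Omega>"
  shows "(\<lambda>x. c *\<^sub>R u x) \<in> L2 \<Omega>"
  using L2_measurable[OF u] L2_square[OF u] by (simp add: L2_def power_mult_distrib)

lemma L2_subspace: "fn.subspace (L2 \<Omega>)"
  using L2_add[of _ \<Omega>] L2_scale[of _ \<Omega>]
  by (auto simp: fn.subspace_def fscale_def plus_fun_def zero_fun_def L2_def[of \<Omega>])

lemma L2_integrable_inner:
  assumes u: "u \<in> L2 \<Omega>" and v: "v \<in> L2 \<Omega>"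
  shows "integrable (lebesgue_on \<Omega>) (\<lambda>x. u x \<bullet> v x)"
proof (rule Bochner_Integration.integrable_bound)
  note [measurable] = L2_measurable[OF u] L2_measurable[OF v]
  show "integrable (lebesgue_on \<Omega>) (\<lambda>x. (norm (u x))\<^sup>2 + (norm (v x))\<^sup>2)"
    using L2_square[OF u] L2_square[OF v] by simp
  show "(\<lambda>x. u x \<bullet> v x) \<in> borel_measurable (lebesgue_on \<Omega>)" by simp
  have "norm (u x \<bullet> v x) \<le> norm ((norm (u x))\<^sup>2 + (norm (v x))\<^sup>2)" for x
  proof -
    have "\<bar>u x \<bullet> v x\<bar> \<le> norm (u x) * norm (v x)" by (rule Cauchy_Schwarz_ineq2)
    also have "\<dots> \<le> 2 * norm (u x) * norm (v x)" by simp
    also have "\<dots> \<le> (norm (u x))\<^sup>2 + (norm (v x))\<^sup>2" by (rule sum_squares_bound)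
    finally show ?thesis by simp
  qed
  then show "AE x in lebesgue_on \<Omega>. norm (u x \<bullet> v x) \<le> norm ((norm (u x))\<^sup>2 + (norm (v x))\<^sup>2)"
    by simp
qed

lemma l2_inner_commute: "l2_inner \<Omega> u v = l2_inner \<Omega> v u"
  by (simp add: l2_inner_def inner_commute)

lemma l2_inner_nonneg: "0 \<le> l2_inner \<Omega> u u"
  by (simp add: l2_inner_def)

lemma l2_inner_add_right:
  assumes "u \<in> L2 \<Omega>" "v \<in> L2 \<Omega>" "w \<in> L2 \<Omega>"
  shows "l2_inner \<Omega> w (u + v) = l2_inner \<Omega> w u + l2_inner \<Omega> w v"
  using L2_integrable_inner[OF assms(3,1)] L2_integrable_inner[OF assms(3,2)]
  by (simp add: l2_inner_def inner_add_right)

lemma l2_inner_scale_right: "l2_inner \<Omega> w (fscale c u) = c * l2_inner \<Omega> w u"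
  by (simp add: l2_inner_def fscale_def)

lemma l2_inner_add_left:
  assumes "u \<in> L2 \<Omega>" "v \<in> L2 \<Omega>" "w \<in> L2 \<Omega>"
  shows "l2_inner \<Omega> (u + v) w = l2_inner \<Omega> u w + l2_inner \<Omega> v w"
  using l2_inner_add_right[OF assms] by (simp only: l2_inner_commute[of \<Omega> _ w])

lemma l2_inner_scale_left: "l2_inner \<Omega> (fscale c u) w = c * l2_inner \<Omega> u w"
  using l2_inner_scale_right[of \<Omega> w c u] by (simp only: l2_inner_commute[of \<Omega> _ w])

lemma l2_inner_cong:
  assumes "AE x in lebesgue_on \<Omega>. u x = v x" "u \<in> L2 \<Omega>" "v \<in> L2 \<Omega>" "w \<in> L2 \<Omega>"
  shows "l2_inner \<Omega> w u = l2_inner \<Omega> w v"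
  unfolding l2_inner_def
proof (rule integral_cong_AE)
  show "AE x in lebesgue_on \<Omega>. w x \<bullet> u x = w x \<bullet> v x"
    using assms(1) by eventually_elim simp
qed (use L2_integrable_inner assms in blast)+

lemma l2_inner_eq_0_imp_AE:
  assumes u: "u \<in> L2 \<Omega>" and "l2_inner \<Omega> u u = 0"
  shows "AE x in lebesgue_on \<Omega>. u x = 0"
proof -
  have "AE x in lebesgue_on \<Omega>. u x \<bullet> u x = 0"
    using assms integral_nonneg_eq_0_iff_AE[OF L2_integrable_inner[OF u u]]
    by (simp add: l2_inner_def)
  then show ?thesis by eventually_elim simp
qed

text \<open>The \<open>L\<^sup>2\<close> inner product is only semidefinite on functions, as opposed to classes modulo equality
  almost everywhere.\<close>

lemma l2_inner_psd:
  assumes X: "fn.subspace X" "X \<subseteq> L2 \<Omega>"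
  shows "psd_op X (mass_op \<Omega> X)"
  unfolding psd_op_def
proof (intro conjI ballI)
  fix u assume u: "u \<in> X"
  then have uL: "u \<in> L2 \<Omega>" using X by auto
  show "mass_op \<Omega> X u \<in> dual X"
    unfolding dual_iff mass_op_def form_op_def using uL X(2)
    by (auto simp: fn.subspace_add[OF X(1)] fn.subspace_scale[OF X(1)] l2_inner_scale_right
        intro!: l2_inner_add_right)
  show "0 \<le> mass_op \<Omega> X u u" using u by (simp add: mass_op_def form_op_def l2_inner_nonneg)
  fix v assume v: "v \<in> X"
  show "mass_op \<Omega> X u v = mass_op \<Omega> X v u"
    using u v by (simp add: mass_op_def form_op_def l2_inner_commute)
qed

lemma l2_norm_nonneg: "0 \<le> l2_norm \<Omega> u"
  by (simp add: l2_norm_def l2_inner_nonneg)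

lemma l2_norm_triangle:
  assumes u: "u \<in> L2 \<Omega>" and v: "v \<in> L2 \<Omega>"
  shows "l2_norm \<Omega> (u + v) \<le> l2_norm \<Omega> u + l2_norm \<Omega> v"
proof (rule power2_le_imp_le)
  have uv: "u + v \<in> L2 \<Omega>" by (rule fn.subspace_add[OF L2_subspace u v])
  have cs: "l2_inner \<Omega> u v \<le> l2_norm \<Omega> u * l2_norm \<Omega> v"
    using psd_Cauchy_Schwarz[OF l2_inner_psd[OF L2_subspace order_refl] L2_subspace u v] u v
    by (simp add: mass_op_def form_op_def l2_norm_def)
  have "(l2_norm \<Omega> (u + v))\<^sup>2 = l2_inner \<Omega> (u + v) (u + v)"
    by (simp add: l2_norm_def l2_inner_nonneg)
  also have "\<dots> = l2_inner \<Omega> u u + 2 * l2_inner \<Omega> u v + l2_inner \<Omega> v v"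
    using u v uv l2_inner_commute[of \<Omega> v u] by (simp add: l2_inner_add_left l2_inner_add_right)
  also have "\<dots> \<le> (l2_norm \<Omega> u + l2_norm \<Omega> v)\<^sup>2"
    using cs by (simp add: power2_sum l2_norm_def l2_inner_nonneg)
  finally show "(l2_norm \<Omega> (u + v))\<^sup>2 \<le> (l2_norm \<Omega> u + l2_norm \<Omega> v)\<^sup>2" .
qed (simp add: l2_norm_nonneg)

lemma l2_tendsto_iff: "l2_tendsto \<Omega> \<phi> u \<longleftrightarrow> (\<lambda>n. l2_norm \<Omega> (\<phi> n - u)) \<longlonglongrightarrow> 0"
  by (simp add: l2_tendsto_def fun_diff_def)

lemma l2_tendsto_add:
  assumes lim: "l2_tendsto \<Omega> \<phi> u" "l2_tendsto \<Omega> \<psi> v"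
    and L2: "\<And>n. \<phi> n \<in> L2 \<Omega>" "\<And>n. \<psi> n \<in> L2 \<Omega>" "u \<in> L2 \<Omega>" "v \<in> L2 \<Omega>"
  shows "l2_tendsto \<Omega> (\<lambda>n. \<phi> n + \<psi> n) (u + v)"
  unfolding l2_tendsto_iff
proof (rule tendsto_sandwich[OF _ _ tendsto_const])
  show "(\<lambda>n. l2_norm \<Omega> (\<phi> n - u) + l2_norm \<Omega> (\<psi> n - v)) \<longlonglongrightarrow> 0"
    using tendsto_add[OF lim[unfolded l2_tendsto_iff]] by simp
  have "l2_norm \<Omega> (\<phi> n + \<psi> n - (u + v)) \<le> l2_norm \<Omega> (\<phi> n - u) + l2_norm \<Omega> (\<psi> n - v)" for n
  proof -
    have "\<phi> n + \<psi> n - (u + v) = (\<phi> n - u) + (\<psi> n - v)" by simp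
    then show ?thesis
      by (simp only:) (intro l2_norm_triangle fn.subspace_diff[OF L2_subspace] L2)
  qed
  then show "\<forall>\<^sub>F n in sequentially.
      l2_norm \<Omega> (\<phi> n + \<psi> n - (u + v)) \<le> l2_norm \<Omega> (\<phi> n - u) + l2_norm \<Omega> (\<psi> n - v)"
    by simp
qed (simp add: l2_norm_nonneg)

lemma l2_tendsto_zero: "l2_tendsto \<Omega> (\<lambda>n. 0) 0"
  by (simp add: l2_tendsto_iff l2_norm_def l2_inner_def)

lemma l2_norm_scale: "l2_norm \<Omega> (fscale c u) = \<bar>c\<bar> * l2_norm \<Omega> u"
proof -
  have "l2_inner \<Omega> (fscale c u) (fscale c u) = c\<^sup>2 * l2_inner \<Omega> u u"
    by (simp add: l2_inner_scale_left l2_inner_scale_right power2_eq_square)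
  then show ?thesis by (simp add: l2_norm_def real_sqrt_mult)
qed

lemma l2_tendsto_scale:
  assumes "l2_tendsto \<Omega> \<phi> u"
  shows "l2_tendsto \<Omega> (\<lambda>n. fscale c (\<phi> n)) (fscale c u)"
proof -
  have "fscale c (\<phi> n) - fscale c u = fscale c (\<phi> n - u)" for n
    by (simp add: fn.scale_right_diff_distrib)
  then show ?thesis
    using tendsto_mult_right_zero[OF assms[unfolded l2_tendsto_iff], of "\<bar>c\<bar>"]
    by (simp add: l2_tendsto_iff l2_norm_scale)
qed

lemma continuous_in_L2:
  fixes f :: "real^3 \<Rightarrow> 'b::euclidean_space"
  assumes \<Omega>: "open \<Omega>" "bounded \<Omega>" and f: "continuous_on UNIV f"
  shows "f \<in> L2 \<Omega>"
proof -
  have m: "\<Omega> \<in> sets lebesgue" using \<Omega>(1) by simp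
  have meas: "f \<in> borel_measurable (lebesgue_on \<Omega>)"
    using f m by (intro continuous_imp_measurable_on_sets_lebesgue) (auto intro: continuous_on_subset)
  have "compact (f ` closure \<Omega>)"
    using \<Omega>(2) f by (intro compact_continuous_image) (auto intro: continuous_on_subset)
  then have "bounded (f ` closure \<Omega>)" by (rule compact_imp_bounded)
  then obtain B where B: "\<And>x. x \<in> closure \<Omega> \<Longrightarrow> norm (f x) \<le> B"
    unfolding bounded_iff by auto
  interpret finite_measure "lebesgue_on \<Omega>"
    by (intro finite_measure_lebesgue_on lmeasurable_open \<Omega>)
  have "integrable (lebesgue_on \<Omega>) (\<lambda>x. (norm (f x))\<^sup>2)"
  proof (rule integrable_const_bound[where B = "B\<^sup>2"])
    show "AE x in lebesgue_on \<Omega>. norm ((norm (f x))\<^sup>2) \<le> B\<^sup>2"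
      using B closure_subset[of \<Omega>] by (intro AE_I2) (auto intro!: power_mono)
  qed (use meas in simp)
  with meas show ?thesis by (simp add: L2_def)
qed

section \<open>Test functions and fields\<close>

lemma Ck_all_differentiable: "(\<And>k. Ck k f) \<Longrightarrow> f differentiable (at x)"
  using Ck.simps(2)[of 0 f] by blast

lemma test_function_Ck: "\<phi> \<in> test_functions \<Omega> \<Longrightarrow> Ck k \<phi>"
  by (simp add: test_functions_def)

lemma test_function_differentiable: "\<phi> \<in> test_functions \<Omega> \<Longrightarrow> \<phi> differentiable (at x)"
  by (intro Ck_all_differentiable test_function_Ck)

lemma test_function_partial_continuous:
  "\<phi> \<in> test_functions \<Omega> \<Longrightarrow> continuous_on UNIV (partial i \<phi>)"
  using test_function_Ck[of \<phi> \<Omega> 1] by simp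

lemma test_functions_subspace: "fn.subspace (test_functions \<Omega>)"
  unfolding fn.subspace_def
proof (intro conjI ballI allI)
  show "0 \<in> test_functions \<Omega>"
    unfolding test_functions_def zero_fun_def by (auto intro: Ck_const exI[of _ "{}"])
next
  fix f g assume f: "f \<in> test_functions \<Omega>" and g: "g \<in> test_functions \<Omega>"
  then obtain K L where KL: "compact K" "K \<subseteq> \<Omega>" "compact L" "L \<subseteq> \<Omega>"
    and zero: "\<And>x. x \<notin> K \<Longrightarrow> f x = 0" "\<And>x. x \<notin> L \<Longrightarrow> g x = 0"
    unfolding test_functions_def by blast
  have "f x + g x = 0" if "x \<notin> K \<union> L" for x using that by (simp add: zero)
  moreover have "compact (K \<union> L)" "K \<union> L \<subseteq> \<Omega>" using KL by auto
  moreover have "Ck k (\<lambda>x. f x + g x)" for k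
    by (intro Ck_add test_function_Ck[OF f] test_function_Ck[OF g])
  ultimately show "f + g \<in> test_functions \<Omega>"
    unfolding test_functions_def plus_fun_def by blast
next
  fix c f assume f: "f \<in> test_functions \<Omega>"
  then obtain K where "compact K" "K \<subseteq> \<Omega>" "\<And>x. x \<notin> K \<Longrightarrow> f x = 0"
    unfolding test_functions_def by blast
  moreover have "Ck k (\<lambda>x. c * f x)" for k by (intro Ck_scale test_function_Ck[OF f])
  ultimately show "fscale c f \<in> test_functions \<Omega>"
    unfolding test_functions_def fscale_def by (auto intro!: exI[of _ K])
qed

lemma test_field_component: "\<phi> \<in> test_fields \<Omega> \<Longrightarrow> (\<lambda>x. \<phi> x $ i) \<in> test_functions \<Omega>"
  by (simp add: test_fields_def)

lemma test_fields_subspace: "fn.subspace (test_fields \<Omega>)"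
proof -
  have add: "(\<lambda>x. f x $ i + g x $ i) \<in> test_functions \<Omega>"
    if "f \<in> test_fields \<Omega>" "g \<in> test_fields \<Omega>" for f g and i :: 3
    using fn.subspace_add[OF test_functions_subspace that[THEN test_field_component, of i]]
    by (simp add: plus_fun_def)
  have scale: "(\<lambda>x. c * f x $ i) \<in> test_functions \<Omega>" if "f \<in> test_fields \<Omega>" for f c and i :: 3
    using fn.subspace_scale[OF test_functions_subspace test_field_component[OF that, of i], of c]
    by (simp add: fscale_def)
  have "(\<lambda>x. 0) \<in> test_functions \<Omega>"
    using fn.subspace_0[OF test_functions_subspace] by (simp add: zero_fun_def)
  then show ?thesis
    unfolding fn.subspace_def using add scale
    by (auto simp: test_fields_def fscale_def plus_fun_def zero_fun_def)
qed

lemma grad_add: "f \<in> test_functions \<Omega> \<Longrightarrow> g \<in> test_functions \<Omega> \<Longrightarrow> grad (f + g) = grad f + grad g"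
  using partial_add[of f _ g] test_function_differentiable
  by (auto simp: fun_eq_iff grad_def vec_eq_iff plus_fun_def)

lemma grad_scale: "f \<in> test_functions \<Omega> \<Longrightarrow> grad (fscale c f) = fscale c (grad f)"
  using partial_scale[of f] test_function_differentiable
  by (auto simp: fun_eq_iff grad_def vec_eq_iff fscale_def)

lemma test_field_partial_add:
  assumes "f \<in> test_fields \<Omega>" "g \<in> test_fields \<Omega>"
  shows "partial i (\<lambda>x. (f + g) x $ j) x = partial i (\<lambda>x. f x $ j) x + partial i (\<lambda>x. g x $ j) x"
  unfolding plus_fun_apply vector_add_component
  by (rule partial_add[OF assms[THEN test_field_component, THEN test_function_differentiable]])

lemma test_field_partial_scale:
  assumes "f \<in> test_fields \<Omega>"
  shows "partial i (\<lambda>x. fscale c f x $ j) x = c * partial i (\<lambda>x. f x $ j) x"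
  unfolding fscale_def vector_scaleR_component real_scaleR_def
  by (rule partial_scale[OF assms[THEN test_field_component, THEN test_function_differentiable]])

lemma curl_add: "f \<in> test_fields \<Omega> \<Longrightarrow> g \<in> test_fields \<Omega> \<Longrightarrow> curl (f + g) = curl f + curl g"
  using test_field_partial_add[of f \<Omega> g]
  by (simp add: fun_eq_iff[of "curl _"] curl_def vec_eq_iff forall_3 del: plus_fun_apply)
    (simp add: curl_def)

lemma curl_scale: "f \<in> test_fields \<Omega> \<Longrightarrow> curl (fscale c f) = fscale c (curl f)"
  using test_field_partial_scale[of f \<Omega>]
  by (simp add: fun_eq_iff[of "curl _"] curl_def vec_eq_iff forall_3)
    (simp add: fscale_def curl_def algebra_simps)

lemma divergence_add:
  "f \<in> test_fields \<Omega> \<Longrightarrow> g \<in> test_fields \<Omega> \<Longrightarrow> divergence (f + g) = divergence f + divergence g"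
  using test_field_partial_add[of f \<Omega> g]
  by (simp add: fun_eq_iff[of "divergence _"] divergence_def sum.distrib del: plus_fun_apply)
    (simp add: divergence_def)

lemma divergence_scale:
  "f \<in> test_fields \<Omega> \<Longrightarrow> divergence (fscale c f) = fscale c (divergence f)"
  using test_field_partial_scale[of f \<Omega>]
  by (simp add: fun_eq_iff[of "divergence _"] divergence_def sum_distrib_left[symmetric])
    (simp add: fscale_def divergence_def)

lemma continuous_on_vec_componentwise:
  fixes f :: "'a::topological_space \<Rightarrow> real^'n"
  assumes "\<And>i. continuous_on S (\<lambda>x. f x $ i)"
  shows "continuous_on S f"
proof -
  have "continuous_on S (\<lambda>x. \<chi> i. f x $ i)" using assms by (rule continuous_on_vec_lambda)
  then show ?thesis by simp
qed

lemma grad_continuous: "f \<in> test_functions \<Omega> \<Longrightarrow> continuous_on UNIV (grad f)"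
  by (rule continuous_on_vec_componentwise)
    (simp add: grad_def test_function_partial_continuous)

lemma test_field_partial_continuous:
  "f \<in> test_fields \<Omega> \<Longrightarrow> continuous_on UNIV (partial i (\<lambda>x. f x $ j))"
  by (rule test_function_partial_continuous[OF test_field_component])

lemma curl_continuous:
  assumes "f \<in> test_fields \<Omega>" shows "continuous_on UNIV (curl f)"
proof (rule continuous_on_vec_componentwise)
  fix i :: 3
  have "\<forall>i. continuous_on UNIV (\<lambda>x. curl f x $ i)"
    unfolding forall_3 curl_def vector_3
    by (intro conjI continuous_on_diff test_field_partial_continuous[OF assms])
  then show "continuous_on UNIV (\<lambda>x. curl f x $ i)" by blast
qed

lemma divergence_continuous: "f \<in> test_fields \<Omega> \<Longrightarrow> continuous_on UNIV (divergence f)"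
  unfolding divergence_def[abs_def] by (intro continuous_on_sum test_field_partial_continuous)

lemma test_function_continuous: "f \<in> test_functions \<Omega> \<Longrightarrow> continuous_on UNIV f"
  using test_function_Ck[of f \<Omega> 0] by simp

lemma test_field_continuous: "f \<in> test_fields \<Omega> \<Longrightarrow> continuous_on UNIV f"
  by (intro continuous_on_vec_componentwise test_function_continuous[OF test_field_component])

section \<open>The fundamental lemma of the calculus of variations\<close>

text \<open>A test function cannot be the indicator of a box, but the bumps converge to it boundedly, so
  the integral of \<open>g\<close> over every box with closure in \<open>\<Omega>\<close> vanishes by dominated convergence.\<close>

lemma AE_zero_of_test_functions:
  fixes g :: "real^3 \<Rightarrow> real"
  assumes \<Omega>: "open \<Omega>" "bounded \<Omega>" and g: "g \<in> L2 \<Omega>"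
    and orth: "\<And>\<phi>. \<phi> \<in> test_functions \<Omega> \<Longrightarrow> l2_inner \<Omega> g \<phi> = 0"
  shows "AE x in lebesgue_on \<Omega>. g x = 0"
proof (rule AE_zero_of_inner_box_integrals[OF \<Omega>(1)])
  have one: "(\<lambda>x. 1::real) \<in> L2 \<Omega>" by (intro continuous_in_L2 \<Omega> continuous_on_const)
  show int: "integrable (lebesgue_on \<Omega>) g" using L2_integrable_inner[OF g one] by simp
  fix a b assume ab: "cbox a b \<subseteq> \<Omega>"
  have bump: "box_bump a b n \<in> test_functions \<Omega>" for n using ab by (rule box_bump_test_function)
  have "(\<lambda>n. integral\<^sup>L (lebesgue_on \<Omega>) (\<lambda>x. g x * box_bump a b n x))
      \<longlonglongrightarrow> integral\<^sup>L (lebesgue_on \<Omega>) (\<lambda>x. g x * indicator (box a b) x)"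
  proof (rule integral_dominated_convergence[where w = "\<lambda>x. \<bar>g x\<bar>"])
    show "(\<lambda>x. g x * indicator (box a b) x) \<in> borel_measurable (lebesgue_on \<Omega>)"
    proof (intro borel_measurable_times borel_measurable_indicator L2_measurable[OF g])
      have "box a b \<subseteq> \<Omega>" using ab box_subset_cbox by blast
      then show "box a b \<in> sets (lebesgue_on \<Omega>)"
        using \<Omega>(1) by (subst sets_restrict_space_iff) auto
    qed
    show "(\<lambda>x. g x * box_bump a b n x) \<in> borel_measurable (lebesgue_on \<Omega>)" for n
      using L2_measurable[OF g] L2_measurable[OF continuous_in_L2[OF \<Omega> test_function_continuous[OF bump]]]
      by (rule borel_measurable_times)
    show "integrable (lebesgue_on \<Omega>) (\<lambda>x. \<bar>g x\<bar>)" using int by simp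
    show "AE x in lebesgue_on \<Omega>. (\<lambda>n. g x * box_bump a b n x) \<longlonglongrightarrow> g x * indicator (box a b) x"
      by (intro AE_I2 tendsto_mult tendsto_const box_bump_tendsto)
    show "AE x in lebesgue_on \<Omega>. norm (g x * box_bump a b n x) \<le> \<bar>g x\<bar>" for n
      using box_bump_bounds[of a b n] by (intro AE_I2) (simp add: abs_mult mult_left_le)
  qed
  moreover have "integral\<^sup>L (lebesgue_on \<Omega>) (\<lambda>x. g x * box_bump a b n x) = 0" for n
    using orth[OF bump] by (simp add: l2_inner_def)
  ultimately show "integral\<^sup>L (lebesgue_on \<Omega>) (\<lambda>x. indicator (box a b) x * g x) = 0"
    by (simp add: LIMSEQ_const_iff mult.commute)
qed

lemma AE_zero_of_test_fields:
  fixes g :: "real^3 \<Rightarrow> real^3"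
  assumes \<Omega>: "open \<Omega>" "bounded \<Omega>" and g: "g \<in> L2 \<Omega>"
    and orth: "\<And>\<phi>. \<phi> \<in> test_fields \<Omega> \<Longrightarrow> l2_inner \<Omega> g \<phi> = 0"
  shows "AE x in lebesgue_on \<Omega>. g x = 0"
proof -
  have "AE x in lebesgue_on \<Omega>. g x $ i = 0" for i
  proof (rule AE_zero_of_test_functions[OF \<Omega>])
    have gi: "(\<lambda>x. g x $ i) \<in> borel_measurable (lebesgue_on \<Omega>)"
      by (rule borel_measurable_continuous_on[where f = "\<lambda>v. v $ i", OF _ L2_measurable[OF g]])
        (rule continuous_on_component[OF continuous_on_id])
    have "integrable (lebesgue_on \<Omega>) (\<lambda>x. (norm (g x $ i))\<^sup>2)"
    proof (rule Bochner_Integration.integrable_bound[OF L2_square[OF g]])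
      show "(\<lambda>x. (norm (g x $ i))\<^sup>2) \<in> borel_measurable (lebesgue_on \<Omega>)" using gi by simp
      show "AE x in lebesgue_on \<Omega>. norm ((norm (g x $ i))\<^sup>2) \<le> norm ((norm (g x))\<^sup>2)"
      proof (rule AE_I2)
        fix x
        have "(norm (g x $ i))\<^sup>2 \<le> (norm (g x))\<^sup>2"
          by (intro power_mono Finite_Cartesian_Product.norm_nth_le norm_ge_zero)
        then show "norm ((norm (g x $ i))\<^sup>2) \<le> norm ((norm (g x))\<^sup>2)" by simp
      qed
    qed
    with gi show "(\<lambda>x. g x $ i) \<in> L2 \<Omega>" by (simp add: L2_def)
    fix \<phi> assume \<phi>: "\<phi> \<in> test_functions \<Omega>"
    have "(\<lambda>x. 0) \<in> test_functions \<Omega>"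
      using fn.subspace_0[OF test_functions_subspace] by (simp add: zero_fun_def)
    with \<phi> have "(\<lambda>x. axis i (\<phi> x) $ j) \<in> test_functions \<Omega>" for j
      by (cases "j = i") (simp_all add: axis_def)
    then have "(\<lambda>x. axis i (\<phi> x)) \<in> test_fields \<Omega>" by (simp add: test_fields_def)
    from orth[OF this] show "l2_inner \<Omega> (\<lambda>x. g x $ i) \<phi> = 0"
      by (simp add: l2_inner_def inner_axis)
  qed
  then have "AE x in lebesgue_on \<Omega>. \<forall>i\<in>UNIV. g x $ i = 0" by (intro AE_finite_allI) auto
  then show ?thesis by eventually_elim (simp add: vec_eq_iff)
qed

section \<open>Weak derivatives\<close>

text \<open>A common frame for the weak gradient, curl and divergence: \<open>\<delta>\<close> is the classical operator that
  acts on the test functions, and \<open>c\<close> is the sign of the integration by parts, \<open>-1\<close> for gradient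
  and divergence and \<open>1\<close> for the curl.\<close>

locale weak_derivative =
  fixes \<Omega> :: "(real^3) set"
    and T :: "(real^3 \<Rightarrow> 'b::euclidean_space) set"
    and \<delta> :: "(real^3 \<Rightarrow> 'b) \<Rightarrow> real^3 \<Rightarrow> 'a::euclidean_space"
    and c :: real
    and P :: "(real^3 \<Rightarrow> 'a) \<Rightarrow> (real^3 \<Rightarrow> 'b) \<Rightarrow> bool"
  assumes P_iff: "P u g \<longleftrightarrow> u \<in> L2 \<Omega> \<and> g \<in> L2 \<Omega> \<and>
      (\<forall>\<phi>\<in>T. l2_inner \<Omega> u (\<delta> \<phi>) = c * l2_inner \<Omega> g \<phi>)"
    and c: "c \<noteq> 0"
    and T_L2: "\<phi> \<in> T \<Longrightarrow> \<phi> \<in> L2 \<Omega>"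
    and \<delta>_L2: "\<phi> \<in> T \<Longrightarrow> \<delta> \<phi> \<in> L2 \<Omega>"
    and T_separating: "w \<in> L2 \<Omega> \<Longrightarrow> (\<And>\<phi>. \<phi> \<in> T \<Longrightarrow> l2_inner \<Omega> w \<phi> = 0) \<Longrightarrow>
      AE x in lebesgue_on \<Omega>. w x = 0"
begin

lemma P_L2: "P u g \<Longrightarrow> u \<in> L2 \<Omega>" "P u g \<Longrightarrow> g \<in> L2 \<Omega>"
  by (auto simp: P_iff)

lemma P_inner: "P u g \<Longrightarrow> \<phi> \<in> T \<Longrightarrow> l2_inner \<Omega> u (\<delta> \<phi>) = c * l2_inner \<Omega> g \<phi>"
  by (simp add: P_iff)

lemma P_add:
  assumes "P u g" "P v h"
  shows "P (u + v) (g + h)"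
  unfolding P_iff
proof (intro conjI ballI)
  show "u + v \<in> L2 \<Omega>" "g + h \<in> L2 \<Omega>"
    by (intro fn.subspace_add[OF L2_subspace] P_L2[OF assms(1)] P_L2[OF assms(2)])+
  fix \<phi> assume \<phi>: "\<phi> \<in> T"
  show "l2_inner \<Omega> (u + v) (\<delta> \<phi>) = c * l2_inner \<Omega> (g + h) \<phi>"
    using l2_inner_add_left[OF P_L2(1)[OF assms(1)] P_L2(1)[OF assms(2)] \<delta>_L2[OF \<phi>]]
      l2_inner_add_left[OF P_L2(2)[OF assms(1)] P_L2(2)[OF assms(2)] T_L2[OF \<phi>]]
      P_inner[OF assms(1) \<phi>] P_inner[OF assms(2) \<phi>]
    by (simp add: distrib_left)
qed

lemma P_scale:
  assumes "P u g"
  shows "P (fscale a u) (fscale a g)"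
  unfolding P_iff
proof (intro conjI ballI)
  show "fscale a u \<in> L2 \<Omega>" "fscale a g \<in> L2 \<Omega>"
    by (intro fn.subspace_scale[OF L2_subspace] P_L2[OF assms])+
  fix \<phi> assume "\<phi> \<in> T"
  then show "l2_inner \<Omega> (fscale a u) (\<delta> \<phi>) = c * l2_inner \<Omega> (fscale a g) \<phi>"
    using P_inner[OF assms] by (simp add: l2_inner_scale_left)
qed

lemma P_zero: "P 0 0"
proof -
  have "(0 :: real^3 \<Rightarrow> 'a) \<in> L2 \<Omega>" "(0 :: real^3 \<Rightarrow> 'b) \<in> L2 \<Omega>"
    by (intro fn.subspace_0[OF L2_subspace])+
  then show ?thesis by (simp add: P_iff l2_inner_def)
qed

lemma P_unique:
  assumes "P u g" "P u h"
  shows "AE x in lebesgue_on \<Omega>. g x = h x"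
proof -
  have "AE x in lebesgue_on \<Omega>. (g - h) x = 0"
  proof (rule T_separating)
    show "g - h \<in> L2 \<Omega>" by (intro fn.subspace_diff[OF L2_subspace] P_L2(2)[OF assms(1)] P_L2(2)[OF assms(2)])
    fix \<phi> assume \<phi>: "\<phi> \<in> T"
    have "P (u + fscale (-1) u) (g + fscale (-1) h)" by (intro P_add P_scale assms)
    then have "P 0 (g - h)" by (simp add: fscale_minus)
    from P_inner[OF this \<phi>] show "l2_inner \<Omega> (g - h) \<phi> = 0"
      using c by (simp add: l2_inner_def)
  qed
  then show ?thesis by eventually_elim simp
qed

lemma P_cong:
  assumes "P u g" "AE x in lebesgue_on \<Omega>. g x = h x" "h \<in> L2 \<Omega>"
  shows "P u h"
  unfolding P_iff
proof (intro conjI ballI)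
  fix \<phi> assume \<phi>: "\<phi> \<in> T"
  show "l2_inner \<Omega> u (\<delta> \<phi>) = c * l2_inner \<Omega> h \<phi>"
    using P_inner[OF assms(1) \<phi>] l2_inner_cong[OF assms(2) P_L2(2)[OF assms(1)] assms(3) T_L2[OF \<phi>]]
    by (simp only: l2_inner_commute[of _ _ \<phi>])
qed (use P_L2[OF assms(1)] assms(3) in auto)

abbreviation d where "d u \<equiv> SOME g. P u g"

text \<open>The chosen derivative \<open>d\<close> is linear up to null sets only, which the inner product does not see.\<close>

lemma d_inner_dual:
  assumes X: "fn.subspace X" and ex: "\<And>u. u \<in> X \<Longrightarrow> \<exists>g. P u g" and w: "k u \<in> L2 \<Omega>"
  shows "form_op X (\<lambda>u v. l2_inner \<Omega> (k u) (d v)) u \<in> dual X"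
proof -
  let ?w = "k u"
  have d: "P v (d v)" if "v \<in> X" for v using ex[OF that] by (rule someI_ex)
  have "l2_inner \<Omega> ?w (d (f + g)) = l2_inner \<Omega> ?w (d f) + l2_inner \<Omega> ?w (d g)"
    if f: "f \<in> X" and g: "g \<in> X" for f g
  proof -
    have fg: "f + g \<in> X" by (rule fn.subspace_add[OF X f g])
    have "l2_inner \<Omega> ?w (d (f + g)) = l2_inner \<Omega> ?w (d f + d g)"
      by (intro l2_inner_cong P_unique[OF d[OF fg]] P_add d f g w P_L2(2)[OF d[OF fg]]
          P_L2(2)[OF P_add[OF d[OF f] d[OF g]]])
    then show ?thesis
      using l2_inner_add_right[OF P_L2(2)[OF d[OF f]] P_L2(2)[OF d[OF g]] w] by simp
  qed
  moreover have "l2_inner \<Omega> ?w (d (fscale a f)) = a * l2_inner \<Omega> ?w (d f)"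
    if f: "f \<in> X" for f a
  proof -
    have af: "fscale a f \<in> X" by (rule fn.subspace_scale[OF X f])
    have "l2_inner \<Omega> ?w (d (fscale a f)) = l2_inner \<Omega> ?w (fscale a (d f))"
      by (intro l2_inner_cong P_unique[OF d[OF af]] P_scale d f w P_L2(2)[OF d[OF af]]
          P_L2(2)[OF P_scale[OF d[OF f]]])
    then show ?thesis by (simp add: l2_inner_scale_right)
  qed
  ultimately show ?thesis
    unfolding dual_iff form_op_def
    by (simp add: fn.subspace_add[OF X] fn.subspace_scale[OF X])
qed

lemma d_psd:
  assumes X: "fn.subspace X" and ex: "\<And>u. u \<in> X \<Longrightarrow> \<exists>g. P u g"
  shows "psd_op X (form_op X (\<lambda>u v. l2_inner \<Omega> (d u) (d v)))"
  unfolding psd_op_def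
proof (intro conjI ballI)
  fix u assume u: "u \<in> X"
  have "P u (d u)" using ex[OF u] by (rule someI_ex)
  then have "d u \<in> L2 \<Omega>" by (rule P_L2(2))
  with X ex show "form_op X (\<lambda>u v. l2_inner \<Omega> (d u) (d v)) u \<in> dual X"
    by (rule d_inner_dual[where k = d])
  show "0 \<le> form_op X (\<lambda>u v. l2_inner \<Omega> (d u) (d v)) u u"
    using u by (simp add: form_op_def l2_inner_nonneg)
  fix v assume v: "v \<in> X"
  show "form_op X (\<lambda>u v. l2_inner \<Omega> (d u) (d v)) u v = form_op X (\<lambda>u v. l2_inner \<Omega> (d u) (d v)) v u"
    using u v by (simp add: form_op_def l2_inner_commute)
qed

lemma d_zero:
  assumes ex: "\<exists>g. P u g" and "l2_inner \<Omega> (d u) (d u) = 0"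
  shows "P u (\<lambda>_. 0)"
proof (rule P_cong)
  show "P u (d u)" using ex by (rule someI_ex)
  from l2_inner_eq_0_imp_AE[OF P_L2(2)[OF this] assms(2)]
  show "AE x in lebesgue_on \<Omega>. (d u) x = 0" .
  show "(\<lambda>_. 0) \<in> L2 \<Omega>" using fn.subspace_0[OF L2_subspace] by (simp add: zero_fun_def)
qed

text \<open>The shape of the spaces with vanishing trace: limits in the graph norm of functions from
  \<open>T'\<close>, with classical derivative \<open>\<delta>'\<close>.\<close>

lemma closure_subspace:
  assumes T': "fn.subspace T'" and T'_L2: "\<And>\<phi>. \<phi> \<in> T' \<Longrightarrow> \<phi> \<in> L2 \<Omega>"
    and \<delta>'_L2: "\<And>\<phi>. \<phi> \<in> T' \<Longrightarrow> \<delta>' \<phi> \<in> L2 \<Omega>"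
    and \<delta>'_add: "\<And>\<phi> \<psi>. \<phi> \<in> T' \<Longrightarrow> \<psi> \<in> T' \<Longrightarrow> \<delta>' (\<phi> + \<psi>) = \<delta>' \<phi> + \<delta>' \<psi>"
    and \<delta>'_scale: "\<And>a \<phi>. \<phi> \<in> T' \<Longrightarrow> \<delta>' (fscale a \<phi>) = fscale a (\<delta>' \<phi>)"
  shows "fn.subspace {u. \<exists>g. P u g \<and> (\<exists>\<phi>. (\<forall>n::nat. \<phi> n \<in> T') \<and> l2_tendsto \<Omega> \<phi> u \<and>
    l2_tendsto \<Omega> (\<lambda>n. \<delta>' (\<phi> n)) g)}" (is "fn.subspace ?C")
  unfolding fn.subspace_def
proof (intro conjI ballI allI)
  have \<delta>0: "\<delta>' 0 = 0"
    using \<delta>'_scale[OF fn.subspace_0[OF T'], of 0] by simp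
  show "0 \<in> ?C"
    by (intro CollectI exI[of _ 0] conjI exI[of _ "\<lambda>n. 0"] allI P_zero fn.subspace_0[OF T'] l2_tendsto_zero)
      (simp only: \<delta>0 l2_tendsto_zero)
next
  fix u v assume "u \<in> ?C" "v \<in> ?C"
  then obtain g h \<phi> \<psi> where u: "P u g" "\<And>n::nat. \<phi> n \<in> T'" "l2_tendsto \<Omega> \<phi> u"
      "l2_tendsto \<Omega> (\<lambda>n. \<delta>' (\<phi> n)) g"
    and v: "P v h" "\<And>n::nat. \<psi> n \<in> T'" "l2_tendsto \<Omega> \<psi> v" "l2_tendsto \<Omega> (\<lambda>n. \<delta>' (\<psi> n)) h"
    by blast
  have "l2_tendsto \<Omega> (\<lambda>n. \<phi> n + \<psi> n) (u + v)"
    by (intro l2_tendsto_add u v T'_L2 P_L2(1)[OF u(1)] P_L2(1)[OF v(1)])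
  moreover have "l2_tendsto \<Omega> (\<lambda>n. \<delta>' (\<phi> n + \<psi> n)) (g + h)"
    unfolding \<delta>'_add[OF u(2) v(2)]
    by (intro l2_tendsto_add u v \<delta>'_L2 P_L2(2)[OF u(1)] P_L2(2)[OF v(1)])
  ultimately show "u + v \<in> ?C"
    using P_add[OF u(1) v(1)] fn.subspace_add[OF T' u(2) v(2)]
    by (intro CollectI exI[of _ "g + h"] conjI exI[of _ "\<lambda>n. \<phi> n + \<psi> n"]) auto
next
  fix a u assume "u \<in> ?C"
  then obtain g \<phi> where u: "P u g" "\<And>n::nat. \<phi> n \<in> T'" "l2_tendsto \<Omega> \<phi> u"
      "l2_tendsto \<Omega> (\<lambda>n. \<delta>' (\<phi> n)) g"
    by blast
  have "l2_tendsto \<Omega> (\<lambda>n. fscale a (\<phi> n)) (fscale a u)"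
    by (rule l2_tendsto_scale[OF u(3)])
  moreover have "l2_tendsto \<Omega> (\<lambda>n. \<delta>' (fscale a (\<phi> n))) (fscale a g)"
    unfolding \<delta>'_scale[OF u(2)] by (rule l2_tendsto_scale[OF u(4)])
  ultimately show "fscale a u \<in> ?C"
    using P_scale[OF u(1)] fn.subspace_scale[OF T' u(2)]
    by (intro CollectI exI[of _ "fscale a g"] conjI exI[of _ "\<lambda>n. fscale a (\<phi> n)"]) auto
qed

end

locale bounded_open_domain =
  fixes \<Omega> :: "(real^3) set"
  assumes \<Omega>: "open \<Omega>" "bounded \<Omega>"
begin

sublocale grad: weak_derivative \<Omega> "test_fields \<Omega>" divergence "-1" "has_weak_grad \<Omega>"
  by unfold_locales (auto simp: has_weak_grad_def
      intro: continuous_in_L2[OF \<Omega>] test_field_continuous divergence_continuous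
        AE_zero_of_test_fields[OF \<Omega>])

sublocale curl: weak_derivative \<Omega> "test_fields \<Omega>" curl 1 "has_weak_curl \<Omega>"
  by unfold_locales (auto simp: has_weak_curl_def
      intro: continuous_in_L2[OF \<Omega>] test_field_continuous curl_continuous
        AE_zero_of_test_fields[OF \<Omega>])

sublocale div: weak_derivative \<Omega> "test_functions \<Omega>" grad "-1" "has_weak_div \<Omega>"
  by unfold_locales (auto simp: has_weak_div_def
      intro: continuous_in_L2[OF \<Omega>] test_function_continuous grad_continuous
        AE_zero_of_test_functions[OF \<Omega>])

lemma H1_0_subspace: "fn.subspace (H1_0 \<Omega>)"
  unfolding H1_0_def
  by (intro grad.closure_subspace test_functions_subspace continuous_in_L2[OF \<Omega>]
      test_function_continuous grad_continuous grad_add grad_scale)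

lemma H_curl_0_subspace: "fn.subspace (H_curl_0 \<Omega>)"
  unfolding H_curl_0_def
  by (intro curl.closure_subspace test_fields_subspace continuous_in_L2[OF \<Omega>]
      test_field_continuous curl_continuous curl_add curl_scale)

lemma H_div_0_subspace: "fn.subspace (H_div_0 \<Omega>)"
  unfolding H_div_0_def
  by (intro div.closure_subspace test_fields_subspace continuous_in_L2[OF \<Omega>]
      test_field_continuous divergence_continuous divergence_add divergence_scale)

end

section \<open>Finite element spaces\<close>

definition finitely_spanned :: "('x \<Rightarrow> 'b::real_vector) set \<Rightarrow> bool" where
  "finitely_spanned X \<longleftrightarrow> (\<exists>B. finite B \<and> X \<subseteq> fn.span B)"

lemma finite_dim_space_iff: "finite_dim_space X \<longleftrightarrow> fn.subspace X \<and> finitely_spanned X"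
  by (simp add: finite_dim_space_def finitely_spanned_def)

lemma finitely_spanned_mono: "finitely_spanned Y \<Longrightarrow> X \<subseteq> Y \<Longrightarrow> finitely_spanned X"
  unfolding finitely_spanned_def by blast

lemma sum_fun_apply: "(\<Sum>e\<in>E. f e) x = (\<Sum>e\<in>E. f e x)"
  by (induction E rule: infinite_finite_induct) auto

text \<open>Stated for a plain function on functions; the shape functions and the piecewise functions are
  built from simpler spaces by such maps.\<close>

lemma span_linear_image:
  assumes add: "\<And>f g. L (f + g) = L f + L g" and scale: "\<And>c f. L (fscale c f) = fscale c (L f)"
    and f: "f \<in> fn.span B"
  shows "L f \<in> fn.span (L ` B)"
  using f
proof (induction rule: fn.span_induct_alt)
  case base
  have "L 0 = 0" using scale[of 0 0] by simp
  then show ?case by (simp only: fn.span_zero)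
next
  case (step c x y)
  have "fscale c (L x) \<in> fn.span (L ` B)"
    using step(1) by (intro fn.span_scale fn.span_base imageI)
  then have "fscale c (L x) + L y \<in> fn.span (L ` B)" using step(2) by (rule fn.span_add)
  then show ?case by (simp only: add scale)
qed

text \<open>A vector field is assembled linearly from its components, a piecewise function from its
  restrictions to the cells.\<close>

lemma finitely_spanned_image_sum:
  assumes P: "finitely_spanned P" and I: "finite I"
    and add: "\<And>i f g. L i (f + g) = L i f + L i g"
    and scale: "\<And>i c f. L i (fscale c f) = fscale c (L i f)"
    and X: "\<And>u. u \<in> X \<Longrightarrow> \<exists>p. (\<forall>i\<in>I. p i \<in> P) \<and> u = (\<Sum>i\<in>I. L i (p i))"
  shows "finitely_spanned X"
proof -
  obtain B where B: "finite B" "P \<subseteq> fn.span B" using P by (auto simp: finitely_spanned_def)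
  let ?B = "\<Union>i\<in>I. L i ` B"
  have "u \<in> fn.span ?B" if u: "u \<in> X" for u
  proof -
    obtain p where p: "\<And>i. i \<in> I \<Longrightarrow> p i \<in> P" and eq: "u = (\<Sum>i\<in>I. L i (p i))"
      using X[OF u] by blast
    have "L i (p i) \<in> fn.span ?B" if i: "i \<in> I" for i
    proof -
      have "L i (p i) \<in> fn.span (L i ` B)"
        using add scale subsetD[OF B(2) p[OF i]] by (rule span_linear_image)
      moreover have "fn.span (L i ` B) \<subseteq> fn.span ?B" using i by (intro fn.span_mono) auto
      ultimately show ?thesis by blast
    qed
    then show ?thesis unfolding eq by (rule fn.span_sum)
  qed
  moreover have "finite ?B" using I B by auto
  ultimately show ?thesis unfolding finitely_spanned_def by blast
qed

lemma finitely_spanned_plus: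
  assumes "finitely_spanned P" "finitely_spanned Q"
    and X: "\<And>u. u \<in> X \<Longrightarrow> \<exists>p\<in>P. \<exists>q\<in>Q. u = p + q"
  shows "finitely_spanned X"
proof -
  obtain B C where B: "finite B" "P \<subseteq> fn.span B" and C: "finite C" "Q \<subseteq> fn.span C"
    using assms(1,2) by (auto simp: finitely_spanned_def)
  have "u \<in> fn.span (B \<union> C)" if u: "u \<in> X" for u
  proof -
    obtain p q where p: "p \<in> P" and q: "q \<in> Q" and eq: "u = p + q" using X[OF u] by blast
    have "p \<in> fn.span (B \<union> C)" "q \<in> fn.span (B \<union> C)"
      using p q B(2) C(2) fn.span_mono[of B "B \<union> C"] fn.span_mono[of C "B \<union> C"] by blast+
    then show ?thesis unfolding eq by (rule fn.span_add)
  qed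
  with B(1) C(1) show ?thesis unfolding finitely_spanned_def by (intro exI[of _ "B \<union> C"]) auto
qed

subsection \<open>Polynomial shape functions\<close>

text \<open>Covers both \<open>polys\<close> and \<open>hom_polys\<close>, which differ in the set of admitted exponents only.\<close>

definition polys_on :: "(nat \<times> nat \<times> nat) set \<Rightarrow> (real^3 \<Rightarrow> real) set" where
  "polys_on I = {p. \<exists>a. p = (\<lambda>x. \<Sum>(i,j,k)\<in>I. a i j k * (x$1)^i * (x$2)^j * (x$3)^k)}"

lemma polys_eq: "polys r = polys_on {(i,j,k). i + j + k \<le> r}"
  and hom_polys_eq: "hom_polys r = polys_on {(i,j,k). i + j + k = r}"
  by (simp_all add: polys_def hom_polys_def polys_on_def)

lemma finite_exponents: "finite {(i,j,k). i + j + k \<le> (r::nat)}" "finite {(i,j,k). i + j + k = (r::nat)}"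
  by (rule finite_subset[of _ "{..r} \<times> {..r} \<times> {..r}"]; auto)+

lemma polys_on_subspace: "fn.subspace (polys_on I)"
  unfolding fn.subspace_def
proof (intro conjI ballI allI)
  show "0 \<in> polys_on I"
    unfolding polys_on_def by (intro CollectI exI[of _ "\<lambda>_ _ _. 0"]) (simp add: fun_eq_iff)
next
  fix p q assume "p \<in> polys_on I" "q \<in> polys_on I"
  then obtain a b where "p = (\<lambda>x. \<Sum>(i,j,k)\<in>I. a i j k * (x$1)^i * (x$2)^j * (x$3)^k)"
    "q = (\<lambda>x. \<Sum>(i,j,k)\<in>I. b i j k * (x$1)^i * (x$2)^j * (x$3)^k)"
    unfolding polys_on_def by blast
  then show "p + q \<in> polys_on I"
    unfolding polys_on_def
    by (intro CollectI exI[of _ "\<lambda>i j k. a i j k + b i j k"])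
      (simp add: fun_eq_iff sum.distrib[symmetric] case_prod_unfold algebra_simps)
next
  fix c p assume "p \<in> polys_on I"
  then obtain a where "p = (\<lambda>x. \<Sum>(i,j,k)\<in>I. a i j k * (x$1)^i * (x$2)^j * (x$3)^k)"
    unfolding polys_on_def by blast
  then show "fscale c p \<in> polys_on I"
    unfolding polys_on_def
    by (intro CollectI exI[of _ "\<lambda>i j k. c * a i j k"])
      (simp add: fun_eq_iff fscale_def sum_distrib_left case_prod_unfold mult.assoc)
qed

lemma polys_on_spanned:
  assumes "finite I"
  shows "finitely_spanned (polys_on I)"
proof -
  let ?m = "\<lambda>(i,j,k) x. (x$1)^i * (x$2)^j * ((x::real^3)$3)^k"
  have "p \<in> fn.span (?m ` I)" if pI: "p \<in> polys_on I" for p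
  proof -
    obtain a where "p = (\<lambda>x. \<Sum>(i,j,k)\<in>I. a i j k * (x$1)^i * (x$2)^j * (x$3)^k)"
      using pI unfolding polys_on_def by blast
    then have "p = (\<Sum>t\<in>I. fscale (case t of (i,j,k) \<Rightarrow> a i j k) (?m t))"
      by (simp add: fun_eq_iff sum_fun_apply fscale_def case_prod_unfold mult.assoc)
    then show ?thesis
      by (simp only:) (intro fn.span_sum fn.span_scale fn.span_base imageI)
  qed
  with assms show ?thesis unfolding finitely_spanned_def by blast
qed

lemma polys_on_continuous:
  assumes "p \<in> polys_on I"
  shows "continuous_on UNIV p"
proof -
  obtain a where "p = (\<lambda>x. \<Sum>(i,j,k)\<in>I. a i j k * (x$1)^i * (x$2)^j * (x$3)^k)"
    using assms unfolding polys_on_def by blast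
  then show ?thesis by (simp add: case_prod_unfold) (intro continuous_intros)
qed

text \<open>Continuity is included because a continuous function that vanishes almost everywhere on an
  open set vanishes there. That is what makes a piecewise function zero once its \<open>L\<^sup>2\<close> norm is.\<close>

definition shape_space :: "(real^3 \<Rightarrow> 'b::real_normed_vector) set \<Rightarrow> bool" where
  "shape_space P \<longleftrightarrow> finite_dim_space P \<and> (\<forall>p\<in>P. continuous_on UNIV p)"

lemma polys_shape: "shape_space (polys r)"
  and hom_polys_shape: "shape_space (hom_polys r)"
  by (auto simp: shape_space_def finite_dim_space_iff polys_eq hom_polys_eq polys_on_subspace
      polys_on_spanned finite_exponents polys_on_continuous)

lemma vec_shape:
  assumes P: "shape_space P"
  shows "shape_space {p :: real^3 \<Rightarrow> real^3. \<forall>i. (\<lambda>x. p x $ i) \<in> P}" (is "shape_space ?V")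
proof -
  have sub: "fn.subspace P" and span: "finitely_spanned P"
    and cont: "\<And>p. p \<in> P \<Longrightarrow> continuous_on UNIV p"
    using P by (auto simp: shape_space_def finite_dim_space_iff)
  have "fn.subspace ?V"
    unfolding fn.subspace_def
  proof (intro conjI ballI allI)
    show "0 \<in> ?V" using fn.subspace_0[OF sub] by (simp add: zero_fun_def)
    fix p q assume p: "p \<in> ?V"
    show "fscale c p \<in> ?V" for c
      using fn.subspace_scale[OF sub, of "\<lambda>x. p x $ _" c] p by (simp add: fscale_def)
    assume "q \<in> ?V"
    then show "p + q \<in> ?V"
      using fn.subspace_add[OF sub, of "\<lambda>x. p x $ _" "\<lambda>x. q x $ _"] p by (simp add: plus_fun_def)
  qed
  moreover have "finitely_spanned ?V"
  proof (rule finitely_spanned_image_sum[OF span, of "UNIV :: 3 set"])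
    show "\<exists>p. (\<forall>i\<in>UNIV. p i \<in> P) \<and> u = (\<Sum>i\<in>UNIV. (\<lambda>x. axis i (p i x)))" if "u \<in> ?V" for u
      using that
      by (intro exI[of _ "\<lambda>i x. u x $ i"])
        (auto simp: fun_eq_iff sum_fun_apply vec_eq_iff axis_def if_distrib cong: if_cong)
  qed (auto simp: fun_eq_iff fscale_def axis_def vec_eq_iff)
  moreover have "continuous_on UNIV p" if "p \<in> ?V" for p
    using that by (intro continuous_on_vec_componentwise cont) auto
  ultimately show ?thesis by (simp add: shape_space_def finite_dim_space_iff)
qed

lemma vec_polys_shape: "shape_space (vec_polys r)"
  and vec_hom_polys_shape: "shape_space (vec_hom_polys r)"
  using vec_shape[OF polys_shape] vec_shape[OF hom_polys_shape]
  by (simp_all add: vec_polys_def vec_hom_polys_def)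

lemma shape_space_plus:
  assumes P: "shape_space P" and Q: "shape_space Q"
  shows "shape_space {p + q | p q. p \<in> P \<and> q \<in> Q}" (is "shape_space ?S")
proof -
  have sub: "fn.subspace P" "fn.subspace Q" and span: "finitely_spanned P" "finitely_spanned Q"
    using P Q by (auto simp: shape_space_def finite_dim_space_iff)
  have "fn.subspace ?S" using fn.subspace_sums[OF sub] .
  moreover have "finitely_spanned ?S" by (rule finitely_spanned_plus[OF span]) blast
  moreover have "continuous_on UNIV u" if "u \<in> ?S" for u
    using that P Q by (auto simp: shape_space_def plus_fun_def intro!: continuous_on_add)
  ultimately show ?thesis by (simp add: shape_space_def finite_dim_space_iff)
qed

lemma shape_space_subspace:
  "shape_space P \<Longrightarrow> fn.subspace Q \<Longrightarrow> Q \<subseteq> P \<Longrightarrow> shape_space Q"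
  unfolding shape_space_def finite_dim_space_iff using finitely_spanned_mono by blast

lemma edge_shapes_shape: "shape_space (edge_shapes \<kappa> r)"
proof (cases \<kappa>)
  case First
  let ?Q = "{q \<in> vec_hom_polys r. \<forall>x. q x \<bullet> x = 0}"
  have "fn.subspace (vec_hom_polys r)"
    using vec_hom_polys_shape by (simp add: shape_space_def finite_dim_space_iff)
  then have "fn.subspace ?Q"
    by (auto simp: fn.subspace_def fscale_def inner_add_left)
  then have "shape_space ?Q" by (rule shape_space_subspace[OF vec_hom_polys_shape]) auto
  from shape_space_plus[OF vec_polys_shape this, of "r - 1"] show ?thesis
    by (simp add: First plus_fun_def conj_assoc)
qed (simp add: vec_polys_shape)

lemma setcompr_image_right:
  "{F p q |p q. p \<in> A \<and> q \<in> L ` B} = {F p (L q) |p q. p \<in> A \<and> q \<in> B}"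
  by blast

lemma face_shapes_shape: "shape_space (face_shapes \<kappa> r)"
proof (cases \<kappa>)
  case First
  let ?L = "\<lambda>q x. q x *\<^sub>R (x::real^3)"
  let ?Q = "?L ` hom_polys (r - 1)"
  have hom: "fn.subspace (hom_polys (r - 1))" "finitely_spanned (hom_polys (r - 1))"
    "\<And>q. q \<in> hom_polys (r - 1) \<Longrightarrow> continuous_on UNIV q"
    using hom_polys_shape by (auto simp: shape_space_def finite_dim_space_iff)
  have add: "?L (p + q) = ?L p + ?L q" for p q by (simp add: fun_eq_iff scaleR_add_left)
  have scale: "?L (fscale c q) = fscale c (?L q)" for c q by (simp add: fun_eq_iff fscale_def)
  have "fn.subspace ?Q"
    unfolding fn.subspace_def
  proof (intro conjI ballI allI)
    show "0 \<in> ?Q" by (rule image_eqI[OF _ fn.subspace_0[OF hom(1)]]) (simp add: fun_eq_iff)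
    fix u v assume "u \<in> ?Q"
    then obtain p where p: "p \<in> hom_polys (r - 1)" and u: "u = ?L p" by blast
    show "fscale c u \<in> ?Q" for c
      unfolding u scale[symmetric] by (intro imageI fn.subspace_scale[OF hom(1)] p)
    assume "v \<in> ?Q"
    then obtain q where q: "q \<in> hom_polys (r - 1)" and v: "v = ?L q" by blast
    show "u + v \<in> ?Q"
      unfolding u v add[symmetric] by (intro imageI fn.subspace_add[OF hom(1)] p q)
  qed
  moreover have "finitely_spanned ?Q"
    by (rule finitely_spanned_image_sum[OF hom(2), of "{()}" "\<lambda>_. ?L", OF _ add scale]) auto
  moreover have "continuous_on UNIV u" if "u \<in> ?Q" for u
    using that hom(3) by (auto intro!: continuous_intros)
  ultimately have "shape_space ?Q" by (simp add: shape_space_def finite_dim_space_iff)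
  from shape_space_plus[OF vec_polys_shape this, of "r - 1"]
  have "shape_space {p + q |p q. p \<in> vec_polys (r - 1) \<and> q \<in> ?Q}" .
  also have "{p + q |p q. p \<in> vec_polys (r - 1) \<and> q \<in> ?Q}
      = {p + ?L q |p q. p \<in> vec_polys (r - 1) \<and> q \<in> hom_polys (r - 1)}"
    by (rule setcompr_image_right)
  also have "\<dots> = face_shapes First r" by (simp add: plus_fun_def)
  finally show ?thesis by (simp add: First)
qed (simp add: vec_polys_shape)

subsection \<open>Piecewise functions\<close>

text \<open>A face of a cell that meets the interior of the cell is the whole cell.\<close>

lemma triangulation_disjoint_interiors:
  assumes "triangulation \<T>" "K \<in> \<T>" "K' \<in> \<T>" "x \<in> interior K" "x \<in> interior K'"
  shows "K = K'"
proof -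
  have f: "(K \<inter> K') face_of K" "(K' \<inter> K) face_of K'"
    using assms(1-3) unfolding triangulation_def by blast+
  have "x \<in> K \<inter> K'" using assms(4,5) interior_subset by blast
  then have "K \<inter> K' = K" "K' \<inter> K = K'"
    using face_of_disjoint_interior[OF f(1)] face_of_disjoint_interior[OF f(2)] assms(4,5) by blast+
  then show ?thesis by blast
qed

lemma piecewiseE:
  assumes "u \<in> piecewise \<T> P" "K \<in> \<T>"
  obtains p where "p \<in> P" "\<And>x. x \<in> interior K \<Longrightarrow> u x = p x"
proof -
  have "\<exists>p\<in>P. \<forall>x\<in>interior K. u x = p x" using assms by (simp add: piecewise_def)
  then show ?thesis using that by blast
qed

lemma piecewise_subspace:
  assumes P: "fn.subspace P"
  shows "fn.subspace (piecewise \<T> P)"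
  unfolding fn.subspace_def
proof (intro conjI ballI allI)
  show "0 \<in> piecewise \<T> P"
    using fn.subspace_0[OF P] by (auto simp: piecewise_def intro!: bexI[of _ 0])
next
  fix u v assume u: "u \<in> piecewise \<T> P" and v: "v \<in> piecewise \<T> P"
  have "\<exists>p\<in>P. \<forall>x\<in>interior K. (u + v) x = p x" if K: "K \<in> \<T>" for K
  proof -
    obtain p where p: "p \<in> P" "\<And>x. x \<in> interior K \<Longrightarrow> u x = p x"
      using u K by (rule piecewiseE) blast
    obtain q where q: "q \<in> P" "\<And>x. x \<in> interior K \<Longrightarrow> v x = q x"
      using v K by (rule piecewiseE) blast
    show ?thesis by (intro bexI[of _ "p + q"] fn.subspace_add[OF P]) (auto simp: p q)
  qed
  then show "u + v \<in> piecewise \<T> P" using u v by (simp add: piecewise_def)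
next
  fix c u assume u: "u \<in> piecewise \<T> P"
  have "\<exists>p\<in>P. \<forall>x\<in>interior K. fscale c u x = p x" if K: "K \<in> \<T>" for K
  proof -
    obtain p where p: "p \<in> P" "\<And>x. x \<in> interior K \<Longrightarrow> u x = p x"
      using u K by (rule piecewiseE) blast
    show ?thesis
      by (intro bexI[of _ "fscale c p"] fn.subspace_scale[OF P]) (auto simp: fscale_def p)
  qed
  then show "fscale c u \<in> piecewise \<T> P" using u by (simp add: piecewise_def fscale_def)
qed

text \<open>A piecewise function is the sum of its restrictions to the open cells: these are disjoint, and
  on the rest of space the function is zero by the normalisation of the representatives.\<close>

lemma piecewise_spanned:
  assumes tri: "triangulation \<T>" and P: "finitely_spanned P"
  shows "finitely_spanned (piecewise \<T> P)"
proof (rule finitely_spanned_image_sum[OF P, of \<T> "\<lambda>K f x. if x \<in> interior K then f x else 0"])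
  show "finite \<T>" using tri by (simp add: triangulation_def)
next
  fix u assume u: "u \<in> piecewise \<T> P"
  then have "\<forall>K\<in>\<T>. \<exists>p. p \<in> P \<and> (\<forall>x\<in>interior K. u x = p x)"
    by (auto simp: piecewise_def Bex_def)
  from bchoice[OF this] obtain p where p: "\<And>K. K \<in> \<T> \<Longrightarrow> p K \<in> P"
    "\<And>K x. K \<in> \<T> \<Longrightarrow> x \<in> interior K \<Longrightarrow> u x = p K x"
    by blast
  have "u x = (\<Sum>K\<in>\<T>. if x \<in> interior K then p K x else 0)" for x
  proof (cases "\<exists>K\<in>\<T>. x \<in> interior K")
    case True
    then obtain K where K: "K \<in> \<T>" "x \<in> interior K" by blast
    have "(\<Sum>L\<in>\<T>. if x \<in> interior L then p L x else 0) = (\<Sum>L\<in>\<T>. if L = K then p K x else 0)"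
      using triangulation_disjoint_interiors[OF tri] K by (intro sum.cong) auto
    also have "\<dots> = p K x" using K tri by (simp add: triangulation_def)
    finally show ?thesis using p(2)[OF K] by simp
  next
    case False
    then have "u x = 0" using u by (simp add: piecewise_def)
    moreover have "(\<Sum>K\<in>\<T>. if x \<in> interior K then p K x else 0) = 0"
      using False by (intro sum.neutral) auto
    ultimately show ?thesis by simp
  qed
  then show "\<exists>p. (\<forall>K\<in>\<T>. p K \<in> P) \<and> u = (\<Sum>K\<in>\<T>. (\<lambda>x. if x \<in> interior K then p K x else 0))"
    using p(1) by (intro exI[of _ p]) (simp add: fun_eq_iff sum_fun_apply)
qed (auto simp: fun_eq_iff fscale_def)

lemma finite_dim_piecewise:
  assumes "triangulation \<T>" "shape_space P" "fn.subspace Z"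
  shows "finite_dim_space (piecewise \<T> P \<inter> Z)"
proof -
  have "fn.subspace (piecewise \<T> P)" "finitely_spanned (piecewise \<T> P)"
    using assms(2) piecewise_subspace piecewise_spanned[OF assms(1)]
    by (auto simp: shape_space_def finite_dim_space_iff)
  then show ?thesis
    unfolding finite_dim_space_iff using assms(3) fn.subspace_inter finitely_spanned_mono inf_le1
    by metis
qed

lemma AE_zero_open_imp_zero:
  fixes f :: "'a::euclidean_space \<Rightarrow> 'b::real_normed_vector"
  assumes G: "open G" and f: "continuous_on G f"
    and ae: "AE x in lebesgue. x \<in> G \<longrightarrow> f x = 0" and x: "x \<in> G"
  shows "f x = 0"
proof (rule ccontr)
  assume "f x \<noteq> 0"
  let ?N = "{x \<in> G. f x \<noteq> 0}"
  have "open ?N"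
    using continuous_open_preimage[OF f G, of "- {0}"]
    by (simp add: vimage_def Int_def open_Compl)
  moreover have "?N \<noteq> {}" using x \<open>f x \<noteq> 0\<close> by blast
  moreover have "negligible ?N"
  proof -
    have "AE x in lebesgue. x \<notin> ?N" using ae by eventually_elim auto
    then show ?thesis
      by (subst negligible_iff_null_sets, subst AE_iff_null_sets) (use \<open>open ?N\<close> in auto)
  qed
  ultimately show False using open_not_negligible by blast
qed

text \<open>Convexity of \<open>\<Omega>\<close> enters because the cells triangulate the closure of \<open>\<Omega>\<close>, whose interior is
  \<open>\<Omega>\<close> itself for an open convex set. On each open cell the shape function then vanishes almost
  everywhere, hence everywhere.\<close>

lemma piecewise_zero:
  assumes \<Omega>: "open \<Omega>" "convex \<Omega>" and mesh: "tetrahedral_mesh \<Omega> \<T>"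
    and P: "shape_space P" and u: "u \<in> piecewise \<T> P"
    and ae: "AE x in lebesgue_on \<Omega>. u x = 0"
  shows "u = 0"
proof
  fix x
  have ae': "AE y in lebesgue. y \<in> \<Omega> \<longrightarrow> u y = 0"
    using ae \<Omega>(1) by (subst (asm) AE_restrict_space_iff) auto
  show "u x = 0 x"
  proof (cases "\<exists>K\<in>\<T>. x \<in> interior K")
    case True
    then obtain K where K: "K \<in> \<T>" "x \<in> interior K" by blast
    obtain p where p: "p \<in> P" "\<And>y. y \<in> interior K \<Longrightarrow> u y = p y"
      using u K(1) by (rule piecewiseE) blast
    have "K \<subseteq> closure \<Omega>" using mesh K(1) by (auto simp: tetrahedral_mesh_def)
    then have "interior K \<subseteq> interior (closure \<Omega>)" by (rule interior_mono)
    also have "\<dots> = \<Omega>" using \<Omega> by (simp add: convex_interior_closure interior_open)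
    finally have sub: "interior K \<subseteq> \<Omega>" .
    have "p x = 0"
    proof (rule AE_zero_open_imp_zero[OF open_interior _ _ K(2)])
      show "continuous_on (interior K) p"
        using P p(1) by (auto simp: shape_space_def intro: continuous_on_subset)
      show "AE y in lebesgue. y \<in> interior K \<longrightarrow> p y = 0"
        using ae' by eventually_elim (use p(2) sub in auto)
    qed
    then show ?thesis using p(2)[OF K(2)] by simp
  next
    case False
    then show ?thesis using u by (simp add: piecewise_def)
  qed
qed

section \<open>The two Hodge Laplacian systems\<close>

text \<open>Two consecutive maps of an exact complex give a saddle point system: \<open>P1\<close> is the weak
  derivative from \<open>X\<close> to \<open>Y\<close> and \<open>P2\<close> the one that leaves \<open>Y\<close>. If \<open>u\<close> has no \<open>D\<close>-energy and
  \<open>R u = 0\<close>, then \<open>u\<close> is the derivative of some \<open>\<tau>\<close> by exactness, and \<open>(u, u) = R u \<tau> = 0\<close>. The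
  curl case uses gradient and curl, the div case curl and divergence.\<close>

lemma complex_saddle_system:
  fixes P1 :: "(real^3 \<Rightarrow> 'a::euclidean_space) \<Rightarrow> (real^3 \<Rightarrow> 'b::euclidean_space) \<Rightarrow> bool"
    and P2 :: "(real^3 \<Rightarrow> 'b) \<Rightarrow> (real^3 \<Rightarrow> 'c::euclidean_space) \<Rightarrow> bool"
  assumes w1: "weak_derivative \<Omega> T1 \<delta>1 c1 P1" and w2: "weak_derivative \<Omega> T2 \<delta>2 c2 P2"
    and X: "finite_dim_space X" and Y: "finite_dim_space Y"
    and ex1: "\<And>\<tau>. \<tau> \<in> X \<Longrightarrow> \<exists>g. P1 \<tau> g" and ex2: "\<And>u. u \<in> Y \<Longrightarrow> \<exists>g. P2 u g"
    and exact: "\<And>u. u \<in> Y \<Longrightarrow> P2 u (\<lambda>_. 0) \<Longrightarrow> \<exists>\<tau>\<in>X. P1 \<tau> u"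
    and separated: "\<And>u. u \<in> Y \<Longrightarrow> (AE x in lebesgue_on \<Omega>. u x = 0) \<Longrightarrow> u = 0"
    and R: "\<And>u. u \<in> Y \<Longrightarrow> R u = form_op X (\<lambda>u \<tau>. l2_inner \<Omega> u (SOME g. P1 \<tau> g)) u"
    and Q: "\<And>\<sigma>. \<sigma> \<in> X \<Longrightarrow> Q \<sigma> = form_op Y (\<lambda>\<sigma> v. l2_inner \<Omega> v (SOME g. P1 \<sigma> g)) \<sigma>"
    and D: "D = form_op Y (\<lambda>u v. l2_inner \<Omega> (SOME g. P2 u g) (SOME g. P2 v g))"
  shows "saddle_system X Y R Q D"
proof -
  interpret d1: weak_derivative \<Omega> T1 \<delta>1 c1 P1 by (rule w1)
  interpret d2: weak_derivative \<Omega> T2 \<delta>2 c2 P2 by (rule w2)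
  have Xs: "fn.subspace X" and Ys: "fn.subspace Y"
    using X Y by (auto simp: finite_dim_space_def)
  have YL: "u \<in> L2 \<Omega>" if "u \<in> Y" for u using ex2[OF that] d2.P_L2(1) by blast
  have d1: "P1 \<tau> (d1.d \<tau>)" if "\<tau> \<in> X" for \<tau> using ex1[OF that] by (rule someI_ex)
  show ?thesis
  proof (unfold_locales)
    show "finite_dim_space X" "finite_dim_space Y" by (rule X, rule Y)
    show "R u \<in> dual X" if u: "u \<in> Y" for u
      unfolding R[OF u] using Xs ex1 YL[OF u] by (rule d1.d_inner_dual[where k = "\<lambda>u. u"])
    show "Q \<sigma> \<in> dual Y" if \<sigma>: "\<sigma> \<in> X" for \<sigma>
    proof -
      have "Q \<sigma> = mass_op \<Omega> Y (d1.d \<sigma>)"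
        unfolding Q[OF \<sigma>] by (simp add: mass_op_def form_op_def l2_inner_commute fun_eq_iff)
      moreover have "mass_op \<Omega> Y w \<in> dual Y" if "w \<in> L2 \<Omega>" for w
        unfolding dual_iff mass_op_def form_op_def using that YL
        by (simp add: fn.subspace_add[OF Ys] fn.subspace_scale[OF Ys] l2_inner_scale_right
            l2_inner_add_right)
      ultimately show ?thesis using d1.P_L2(2)[OF d1[OF \<sigma>]] by simp
    qed
    show "Q \<sigma> u = R u \<sigma>" if "\<sigma> \<in> X" "u \<in> Y" for \<sigma> u
      using that by (simp add: Q R form_op_def)
    show "psd_op Y D" unfolding D using Ys ex2 by (rule d2.d_psd)
    show "u = 0" if u: "u \<in> Y" and D0: "D u u = 0" and R0: "\<And>\<tau>. \<tau> \<in> X \<Longrightarrow> R u \<tau> = 0" for u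
    proof -
      have "l2_inner \<Omega> (d2.d u) (d2.d u) = 0" using D0 u by (simp add: D form_op_def)
      then have "P2 u (\<lambda>_. 0)" by (rule d2.d_zero[OF ex2[OF u]])
      then obtain \<tau> where \<tau>: "\<tau> \<in> X" "P1 \<tau> u" using exact[OF u] by blast
      have "l2_inner \<Omega> u u = l2_inner \<Omega> u (d1.d \<tau>)"
        by (rule l2_inner_cong[OF d1.P_unique[OF \<tau>(2) d1[OF \<tau>(1)]] YL[OF u]
              d1.P_L2(2)[OF d1[OF \<tau>(1)]] YL[OF u]])
      also have "\<dots> = R u \<tau>" using u \<tau> by (simp add: R form_op_def)
      also have "\<dots> = 0" by (rule R0[OF \<tau>(1)])
      finally show ?thesis using separated[OF u l2_inner_eq_0_imp_AE[OF YL[OF u]]] by blast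
    qed
  qed
qed

theorem theorem4p8:
  fixes \<Omega> :: "(real^3) set"
    and H :: "real set"
    and \<T> :: "real \<Rightarrow> (real^3) set set"
    and S W :: "real \<Rightarrow> (real^3 \<Rightarrow> real) set"
    and U V :: "real \<Rightarrow> (real^3 \<Rightarrow> real^3) set"
    and r\<^sub>S r\<^sub>U r\<^sub>V r\<^sub>W :: nat
    and k\<^sub>U k\<^sub>V :: kind
    and Mv' :: "real \<Rightarrow> (real^3 \<Rightarrow> real) \<Rightarrow> (real^3 \<Rightarrow> real) \<Rightarrow> real"
    and Me' :: "real \<Rightarrow> (real^3 \<Rightarrow> real^3) \<Rightarrow> (real^3 \<Rightarrow> real^3) \<Rightarrow> real"
  assumes "convex_polyhedral_domain \<Omega>"
    and "\<And>h. h \<in> H \<Longrightarrow> tetrahedral_mesh \<Omega> (\<T> h) \<and> mesh_size (\<T> h) = h"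
    and "shape_regular H \<T>" and "quasi_uniform H \<T>"
    and "1 \<le> r\<^sub>S" and "1 \<le> r\<^sub>U" and "1 \<le> r\<^sub>V"
    and "\<And>h. h \<in> H \<Longrightarrow> S h = lagrange_space \<Omega> (\<T> h) r\<^sub>S"
    and "\<And>h. h \<in> H \<Longrightarrow> U h = edge_space \<Omega> (\<T> h) k\<^sub>U r\<^sub>U"
    and "\<And>h. h \<in> H \<Longrightarrow> V h = face_space \<Omega> (\<T> h) k\<^sub>V r\<^sub>V"
    and "\<And>h. h \<in> H \<Longrightarrow> W h = dg_space \<Omega> (\<T> h) r\<^sub>W"
    and "\<And>h. h \<in> H \<Longrightarrow> exact_complex \<Omega> (S h) (U h) (V h) (W h)"
    and "\<And>h. h \<in> H \<Longrightarrow> spd_op (S h) (Mv' h)"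
    and "\<And>h. h \<in> H \<Longrightarrow> spd_op (U h) (Me' h)"
    and "uniformly_spectrally_equivalent H S Mv' (\<lambda>h. mass_op \<Omega> (S h))"
    and "uniformly_spectrally_equivalent H U Me' (\<lambda>h. mass_op \<Omega> (U h))"
  shows "uniform_preconditioner H (\<lambda>h. S h \<times> U h)
           (\<lambda>h. prod_norm (mass_op \<Omega> (S h)) (Ac_op \<Omega> (S h) (U h)))
           (\<lambda>h. Gc_op \<Omega> (S h) (U h) (Mv' h)) (\<lambda>h. Lc_op \<Omega> (S h) (U h))
       \<and> uniform_preconditioner H (\<lambda>h. U h \<times> V h)
           (\<lambda>h. prod_norm (mass_op \<Omega> (U h)) (Ad_op \<Omega> (U h) (V h)))
           (\<lambda>h. Gd_op \<Omega> (U h) (V h) (Me' h)) (\<lambda>h. Ld_op \<Omega> (U h) (V h))"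
proof -
  have dom: "open \<Omega>" "bounded \<Omega>" "convex \<Omega>"
    using assms(1) by (auto simp: convex_polyhedral_domain_def)
  interpret bounded_open_domain \<Omega> using dom by unfold_locales
  have mesh: "tetrahedral_mesh \<Omega> (\<T> h)" "triangulation (\<T> h)" if "h \<in> H" for h
    using assms(2)[OF that] by (auto simp: tetrahedral_mesh_def)
  have S: "finite_dim_space (S h)" if h: "h \<in> H" for h
    unfolding assms(8)[OF h] lagrange_space_def
    by (intro finite_dim_piecewise mesh h polys_shape H1_0_subspace)
  have U: "finite_dim_space (U h)" if h: "h \<in> H" for h
    unfolding assms(9)[OF h] edge_space_def
    by (intro finite_dim_piecewise mesh h edge_shapes_shape H_curl_0_subspace)
  have V: "finite_dim_space (V h)" if h: "h \<in> H" for h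
    unfolding assms(10)[OF h] face_space_def
    by (intro finite_dim_piecewise mesh h face_shapes_shape H_div_0_subspace)
  have U0: "u = 0" if h: "h \<in> H" and "u \<in> U h" "AE x in lebesgue_on \<Omega>. u x = 0" for h u
    using that(2,3) unfolding assms(9)[OF h] edge_space_def
    by (intro piecewise_zero[OF dom(1,3) mesh(1)[OF h] edge_shapes_shape]) auto
  have V0: "v = 0" if h: "h \<in> H" and "v \<in> V h" "AE x in lebesgue_on \<Omega>. v x = 0" for h v
    using that(2,3) unfolding assms(10)[OF h] face_space_def
    by (intro piecewise_zero[OF dom(1,3) mesh(1)[OF h] face_shapes_shape]) auto
  have grad_ex: "\<exists>g. has_weak_grad \<Omega> \<tau> g" if "h \<in> H" "\<tau> \<in> S h" for h \<tau>
    using assms(12)[OF that(1)] that(2) unfolding exact_complex_def by blast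
  have curl_ex: "\<exists>g. has_weak_curl \<Omega> u g" if "h \<in> H" "u \<in> U h" for h u
    using assms(12)[OF that(1)] that(2) unfolding exact_complex_def by blast
  have div_ex: "\<exists>g. has_weak_div \<Omega> v g" if "h \<in> H" "v \<in> V h" for h v
    using assms(12)[OF that(1)] that(2) unfolding exact_complex_def by blast
  have exact_U: "\<exists>\<tau>\<in>S h. has_weak_grad \<Omega> \<tau> u"
    if "h \<in> H" "u \<in> U h" "has_weak_curl \<Omega> u (\<lambda>_. 0)" for h u
    using assms(12)[OF that(1)] that(2,3) unfolding exact_complex_def by blast
  have exact_V: "\<exists>u\<in>U h. has_weak_curl \<Omega> u v"
    if "h \<in> H" "v \<in> V h" "has_weak_div \<Omega> v (\<lambda>_. 0)" for h v
    using assms(12)[OF that(1)] that(2,3) unfolding exact_complex_def by blast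
  have SL: "S h \<subseteq> L2 \<Omega>" and UL: "U h \<subseteq> L2 \<Omega>" if "h \<in> H" for h
    using grad_ex[OF that] curl_ex[OF that] grad.P_L2(1) curl.P_L2(1) by blast+
  have curl_system: "saddle_system (S h) (U h) (Bc_op \<Omega> (S h))
      (transpose_op (U h) (Bc_op \<Omega> (S h))) (CMC_op \<Omega> (U h))" if h: "h \<in> H" for h
    by (rule complex_saddle_system[OF grad.weak_derivative_axioms curl.weak_derivative_axioms
          S[OF h] U[OF h] grad_ex[OF h] curl_ex[OF h] exact_U[OF h] U0[OF h]])
      (simp_all add: Bc_op_def transpose_op_def CMC_op_def form_op_def weak_grad_def weak_curl_def
        fun_eq_iff)
  have div_system: "saddle_system (U h) (V h) (transpose_op (U h) (Cd_op \<Omega> (V h)))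
      (Cd_op \<Omega> (V h)) (BMB_op \<Omega> (V h))" if h: "h \<in> H" for h
    by (rule complex_saddle_system[OF curl.weak_derivative_axioms div.weak_derivative_axioms
          U[OF h] V[OF h] curl_ex[OF h] div_ex[OF h] exact_V[OF h] V0[OF h]])
      (simp_all add: Cd_op_def transpose_op_def BMB_op_def form_op_def weak_curl_def weak_div_def
        l2_inner_commute fun_eq_iff)
  have sub: "fn.subspace (S h)" "fn.subspace (U h)" if "h \<in> H" for h
    using S[OF that] U[OF that] by (auto simp: finite_dim_space_def)
  show ?thesis
    unfolding Ac_op_def Gc_op_def Lc_op_def Ad_op_def Gd_op_def Ld_op_def
    by (intro conjI uniform_preconditioner_saddle curl_system div_system l2_inner_psd sub SL UL
        assms(13-16))
qed

end
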